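(* Let $L\ge 2$, $c>5/2$, and let $p_{lk}=n^{-c}$ for all nodes in the Bayesian CART prior. There exist a function $f_0$ satisfying Assumption (F)(b) (stated in the context) and a constant $C>1$ such that, with probability at least $1-4/n$, the $\epsilon$-mixing time of the Bayesian CART Markov chain satisfies $$\tau_\epsilon>\log\left(\frac1{2\epsilon}\right)\frac14\left[\left(\frac{n^{(c-3/2)}/4-1}{C}\right)^{L-2}-3\right].$$
   Context: Model: $n=2^{L_{\max}+1}$, $x_i=i/n$, and $Y_i=f_0(x_i)+\varepsilon_i$ for $i=1,\dots,n$ with $\varepsilon_i$ i.i.d. $\mathcal N(0,1)$; probability refers to the law of $Y=(Y_1,\dots,Y_n)'$. Haar basis: $\psi_{-10}=I_{[0,1]}$ and $\psi_{lk}(x)=2^{l/2}\psi(2^lx-k)$ for $l\ge 0$, $0\le k<2^l$, with $\psi=I_{(0,1/2]}-I_{(1/2,1]}$. $\bm X$ is the $n\times p$ matrix, $p=2^{L_{\max}}=n/2$, whose columns are $(\psi_{lk}(x_i))_{i\le n}$ for $(l,k)=(-1,0)$ and $0\le l<L_{\max}$, $0\le k<2^l$ (so $\bm X'\bm X=nI_p$). Trees: fix $L\le L_{\max}$. A tree $\mathcal T$ of depth at most $L$ is determined by its set of internal nodes $\mathcal T_{int}$, consisting of $(-1,0)$ together with a (possibly empty) set of nodes $(l,k)$, $0\le l<L$, $0\le k<2^l$, that contains with each $(l,k)$, $l\ge1$, its parent $(l-1,\lfloor k/2\rfloor)$. The children of $(l,k)$ ($l\ge 0$) are $(l+1,2k),(l+1,2k+1)$;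 the only child of $(-1,0)$ is $(0,0)$. The external nodes $\mathcal T_{ext}$ are the nodes not in $\mathcal T_{int}$ that are children of nodes in $\mathcal T_{int}$. $\mathbb T_L$ is the set of all such trees; $\mathcal T_{null}$ has internal node set $\{(-1,0)\}$; $\mathcal T^L_{full}$ has all nodes with $l<L$ internal. $\mathcal P(\mathcal T)$ is the set of pre-terminal nodes: $(l,k)\in\mathcal T_{int}$, $l\ge0$, with both children in $\mathcal T_{ext}$. Bayesian CART prior and posterior: $\Pi(\mathcal T)\propto\prod_{(l,k)\in\mathcal T_{int}}p_{lk}\prod_{(l,k)\in\mathcal T_{ext}}(1-p_{lk})$ on $\mathbb T_L$; given $\mathcal T$, the coefficients $\beta_{lk}$, $(l,k)\in\mathcal T_{int}$, are i.i.d. $\mathcal N(0,1)$ and all others are $0$; the likelihood is $Y\mid\beta\sim\mathcal N(\bm X\beta,I_n)$. Equivalently $\Pi(\mathcal T\mid Y)\propto\Pi(\mathcal T)N_Y(\mathcal T)$ with $N_Y(\mathcal T)=(2\pi)^{-n/2}(1+n)^{-|\mathcal T_{ext}|/2}\exp\{-\frac12Y'[I-\bm X_{\mathcal T}\Sigma_{\mathcal T}\bm X_{\mathcal T}']Y\}$, $\Sigma_{\mathcal T}=\frac n{n+1}(\bm X_{\mathcal T}'\bm X_{\mathcal T})^{-1}$, $\bm X_{\mathcal T}$ being the columns of $\bm X$ indexed by $\mathcal T_{int}$. Assumption (F): $f_0=\sum_{(l,k)\in\mathcal B}\beta^*_{lk}\psi_{lk}$ for some $\mathcal B\subseteq\{(l,k):l<L\}$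 with $A\log n/\sqrt n<|\beta^*_{lk}|<C_{f_0}$ for all $(l,k)\in\mathcal B$, for some constants $A>0$, $C_{f_0}>0$. (b): $\mathcal B$ is not the internal node set of a tree in $\mathbb T_L$. Bayesian CART chain (Metropolis--Hastings on $\mathbb T_L$): the proposal is $S(\mathcal T\to\widetilde{\mathcal T})=\gamma(\mathcal T)S_{GROW}(\mathcal T\to\widetilde{\mathcal T})+(1-\gamma(\mathcal T))S_{PRUNE}(\mathcal T\to\widetilde{\mathcal T})$ with $\gamma(\mathcal T)=1/2$ for $\mathcal T\notin\{\mathcal T_{null},\mathcal T^L_{full}\}$, $\gamma(\mathcal T_{null})=1$, $\gamma(\mathcal T^L_{full})=0$. GROW picks uniformly $(l,k)\in\mathcal T_{ext}$ and makes it internal, $S_{GROW}=1/|\mathcal T_{ext}|$ (a proposal outside $\mathbb T_L$ has zero posterior probability and is rejected); PRUNE picks uniformly $(l,k)\in\mathcal P(\mathcal T)$ and makes it external, $S_{PRUNE}=1/|\mathcal P(\mathcal T)|$. A proposal is accepted with probability $\alpha(\mathcal T,\widetilde{\mathcal T})=\min\{1,\frac{\Pi(\widetilde{\mathcal T}\mid Y)S(\widetilde{\mathcal T}\to\mathcal T)}{\Pi(\mathcal T\mid Y)S(\mathcal T\to\widetilde{\mathcal T})}\}$; otherwise the chain stays. With $\widetilde P$ the resulting transition matrix, the chain analysed is the lazy chain $P=\widetilde P/2+I/2$. Mixing time: $\tau_\epsilon=\max_{\mathcal T\in\mathbb T_L}\min\{t\in\mathbb N:\|P^{t'}(\mathcal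 T,\cdot)-\Pi(\cdot\mid Y)\|_{TV}\le\epsilon\text{ for all }t'\ge t\}$, $\epsilon\in(0,1)$. "Constant $C$" means not depending on $n,L,\epsilon$. *)

theory Defs
  imports "HOL-Probability.Probability"
begin

section \<open>Haar basis and regression model\<close>

text \<open>\<open>Root\<close> is the node (-1,0); \<open>Node l k\<close> is the node (l,k) with l \<ge> 0.\<close>

datatype node = Root | Node nat nat

text \<open>All nodes of level less than \<open>L\<close>, the node (-1,0) included.\<close>

definition nodes :: "nat \<Rightarrow> node set" where
  "nodes L = insert Root {Node l k | l k. l < L \<and> k < 2 ^ l}"

definition haar_mother :: "real \<Rightarrow> real" where
  "haar_mother x = indicator {0<..1/2} x - indicator {1/2<..1} x"

fun haar :: "node \<Rightarrow> real \<Rightarrow> real" where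
  "haar Root x = indicator {0..1} x"
| "haar (Node l k) x = 2 powr (real l / 2) * haar_mother (2 ^ l * x - real k)"

text \<open>The vector \<open>Y\<close> of observations is indexed by \<open>{1..n}\<close>.\<close>

definition law_Y :: "nat \<Rightarrow> (real \<Rightarrow> real) \<Rightarrow> (nat \<Rightarrow> real) measure" where
  "law_Y n f0 = PiM {1..n} (\<lambda>i. density lborel (normal_density (f0 (real i / real n)) 1))"

section \<open>Trees, represented by their sets of internal nodes\<close>

definition trees :: "nat \<Rightarrow> node set set" where
  "trees L = {T. T \<subseteq> nodes L \<and> Root \<in> T \<and>
                 (\<forall>l k. Node (Suc l) k \<in> T \<longrightarrow> Node l (k div 2) \<in> T)}"

fun children :: "node \<Rightarrow> node set" where
  "children Root = {Node 0 0}"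
| "children (Node l k) = {Node (Suc l) (2 * k), Node (Suc l) (2 * k + 1)}"

text \<open>External nodes may have level \<open>L\<close>, which is the case for the children of the internal
  nodes of level \<open>L - 1\<close>.\<close>

definition ext_nodes :: "node set \<Rightarrow> node set" where
  "ext_nodes T = (\<Union>v\<in>T. children v) - T"

definition preterminal :: "node set \<Rightarrow> node set" where
  "preterminal T = {v \<in> T. v \<noteq> Root \<and> children v \<subseteq> ext_nodes T}"

section \<open>Sparse signals whose support is not a tree\<close>

definition assumption_F_b :: "real \<Rightarrow> real \<Rightarrow> nat \<Rightarrow> nat \<Rightarrow> (real \<Rightarrow> real) \<Rightarrow> bool" where
  "assumption_F_b A C_f0 n L f0 \<longleftrightarrow>
     (\<exists>B \<beta>. B \<subseteq> nodes L \<and>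
            (\<forall>x\<in>{0..1}. f0 x = (\<Sum>v\<in>B. \<beta> v * haar v x)) \<and>
            (\<forall>v\<in>B. A * ln (real n) / sqrt (real n) < \<bar>\<beta> v\<bar> \<and> \<bar>\<beta> v\<bar> < C_f0) \<and>
            B \<notin> trees L)"

section \<open>Prior and posterior\<close>

definition prior_weight :: "(node \<Rightarrow> real) \<Rightarrow> node set \<Rightarrow> real" where
  "prior_weight p T = (\<Prod>v\<in>T. p v) * (\<Prod>v\<in>ext_nodes T. 1 - p v)"

definition prior :: "nat \<Rightarrow> (node \<Rightarrow> real) \<Rightarrow> node set \<Rightarrow> real" where
  "prior L p T = prior_weight p T / (\<Sum>T'\<in>trees L. prior_weight p T')"

text \<open>Density at \<open>Y\<close> of the normal law with mean \<open>X \<beta>\<close> and identity covariance,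
  when the coefficients vanish outside \<open>T\<close>.\<close>

definition likelihood :: "nat \<Rightarrow> node set \<Rightarrow> (node \<Rightarrow> real) \<Rightarrow> (nat \<Rightarrow> real) \<Rightarrow> real" where
  "likelihood n T \<beta> Y =
     (\<Prod>i\<in>{1..n}. normal_density (\<Sum>v\<in>T. haar v (real i / real n) * \<beta> v) 1 (Y i))"

text \<open>The coefficients are integrated out with respect to their independent standard normal
  prior. Since X'X = nI this is \<open>N\<^sub>Y(T)\<close>, the product of (2 pi)^(-n/2), (1+n)^(-|ext T|/2) and
  the exponential of minus half the quadratic form of I - X_T Sigma_T X_T' at \<open>Y\<close>, with
  Sigma_T = n/(n+1) (X_T'X_T)^(-1).\<close>

definition marginal_likelihood :: "nat \<Rightarrow> node set \<Rightarrow> (nat \<Rightarrow> real) \<Rightarrow> real" where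
  "marginal_likelihood n T Y =
     (\<integral>\<beta>. likelihood n T \<beta> Y \<partial>PiM T (\<lambda>_. density lborel std_normal_density))"

definition posterior ::
    "nat \<Rightarrow> nat \<Rightarrow> (node \<Rightarrow> real) \<Rightarrow> (nat \<Rightarrow> real) \<Rightarrow> node set \<Rightarrow> real" where
  "posterior n L p Y T =
     prior L p T * marginal_likelihood n T Y /
     (\<Sum>T'\<in>trees L. prior L p T' * marginal_likelihood n T' Y)"

section \<open>The Metropolis--Hastings chain\<close>

definition S_grow :: "node set \<Rightarrow> node set \<Rightarrow> real" where
  "S_grow T T' = (if \<exists>v\<in>ext_nodes T. T' = insert v T then 1 / real (card (ext_nodes T)) else 0)"

definition S_prune :: "node set \<Rightarrow> node set \<Rightarrow> real" where
  "S_prune T T' = (if \<exists>v\<in>preterminal T. T' = T - {v} then 1 / real (card (preterminal T)) else 0)"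

definition grow_prob :: "nat \<Rightarrow> node set \<Rightarrow> real" where
  "grow_prob L T = (if T = {Root} then 1 else if T = nodes L then 0 else 1/2)"

definition proposal :: "nat \<Rightarrow> node set \<Rightarrow> node set \<Rightarrow> real" where
  "proposal L T T' = grow_prob L T * S_grow T T' + (1 - grow_prob L T) * S_prune T T'"

definition acceptance ::
    "nat \<Rightarrow> nat \<Rightarrow> (node \<Rightarrow> real) \<Rightarrow> (nat \<Rightarrow> real) \<Rightarrow> node set \<Rightarrow> node set \<Rightarrow> real" where
  "acceptance n L p Y T T' =
     min 1 (posterior n L p Y T' * proposal L T' T / (posterior n L p Y T * proposal L T T'))"

text \<open>Proposals outside \<^term>\<open>trees L\<close> are rejected: their probability goes to the diagonal.\<close>

definition mh_kernel ::
    "nat \<Rightarrow> nat \<Rightarrow> (node \<Rightarrow> real) \<Rightarrow> (nat \<Rightarrow> real) \<Rightarrow> node set \<Rightarrow> node set \<Rightarrow> real" where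
  "mh_kernel n L p Y T T' =
     (if T' \<noteq> T then proposal L T T' * acceptance n L p Y T T'
      else 1 - (\<Sum>U\<in>trees L - {T}. proposal L T U * acceptance n L p Y T U))"

definition lazy_kernel ::
    "nat \<Rightarrow> nat \<Rightarrow> (node \<Rightarrow> real) \<Rightarrow> (nat \<Rightarrow> real) \<Rightarrow> node set \<Rightarrow> node set \<Rightarrow> real" where
  "lazy_kernel n L p Y T T' = mh_kernel n L p Y T T' / 2 + (if T' = T then 1/2 else 0)"

fun kernel_pow :: "'a set \<Rightarrow> ('a \<Rightarrow> 'a \<Rightarrow> real) \<Rightarrow> nat \<Rightarrow> 'a \<Rightarrow> 'a \<Rightarrow> real" where
  "kernel_pow S P 0 x y = (if x = y then 1 else 0)"
| "kernel_pow S P (Suc t) x y = (\<Sum>z\<in>S. P x z * kernel_pow S P t z y)"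

section \<open>Mixing time\<close>

definition tv_dist :: "'a set \<Rightarrow> ('a \<Rightarrow> real) \<Rightarrow> ('a \<Rightarrow> real) \<Rightarrow> real" where
  "tv_dist S \<mu> \<nu> = (MAX A\<in>Pow S. \<bar>(\<Sum>x\<in>A. \<mu> x) - (\<Sum>x\<in>A. \<nu> x)\<bar>)"

text \<open>Times range over the positive integers. Allowing \<open>t = 0\<close> makes a difference only if
  every point of \<open>S\<close> has mass at least \<open>1 - \<epsilon>\<close> under \<open>\<mu>\<close>, which for \<open>\<epsilon> < 1/2\<close> is impossible
  for a probability vector \<open>\<mu>\<close> on at least two points. The minimum is \<open>\<infinity>\<close> for a chain that
  does not get \<open>\<epsilon>\<close>-close to \<open>\<mu>\<close> for good.\<close>

definition mixing_time ::
    "'a set \<Rightarrow> ('a \<Rightarrow> 'a \<Rightarrow> real) \<Rightarrow> ('a \<Rightarrow> real) \<Rightarrow> real \<Rightarrow> enat" where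
  "mixing_time S P \<mu> \<epsilon> =
     (MAX x\<in>S. INF t\<in>{t. 1 \<le> t \<and> (\<forall>t'\<ge>t. tv_dist S (kernel_pow S P t' x) \<mu> \<le> \<epsilon>)}. enat t)"

definition cart_mixing_time ::
    "nat \<Rightarrow> nat \<Rightarrow> (node \<Rightarrow> real) \<Rightarrow> (nat \<Rightarrow> real) \<Rightarrow> real \<Rightarrow> enat" where
  "cart_mixing_time n L p Y \<epsilon> =
     mixing_time (trees L) (lazy_kernel n L p Y) (posterior n L p Y) \<epsilon>"

end

theory Submission
  imports Defs
begin

text \<open>The signal is a needle at the bottom of the tree: \<open>f0\<close> is a large multiple \<open>b\<close> of the one Haar
  function at the node (L-1,0), so its support is not a tree. A tree can use the signal only after the
  whole path (0,0), ..., (L-2,0) has become internal, and the \<open>L - 1\<close> nodes on that path carry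
  nothing but noise.

  Because the design is orthogonal, the posterior is up to normalization a product over the
  internal nodes (\<open>posterior_eq_tree_weight\<close>). Let \<open>q\<close> be the prior splitting probability
  \<open>n powr (-c)\<close> times the evidence of a node, which is about (1+n)^(-1/2) exp(z^2/2), where \<open>z\<close> is the
  noise in that coefficient, of variance 1. Uniformly over all nodes z^2 is at most 4 log n with
  probability at least \<open>1 - 1/n\<close> (\<open>quiet_noise_likely\<close>), so a noise node has \<open>q\<close> at most
  \<open>w = n powr -(c - 3/2)\<close>. Since \<open>c > 5/2\<close>, \<open>n * w\<close> is below 1, and therefore the sum of the
  products of \<open>q\<close> over all sets of noise nodes, whether they are trees or not, stays bounded. Hence the
  trees that contain the path but not yet the signal have posterior mass of order w^(L-1) compared
  with the null tree. They are the only gate between the trees without the signal node and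
  those with it, and the signal, being constant in \<open>n\<close>, gives the latter set at least half of the mass.
  This is the bottleneck (\<open>spine_bottleneck\<close>).

  A bottleneck slows the chain down at every accuracy \<open>\<epsilon>\<close>, and the factor log(1/(2 \<epsilon>)) asks for
  geometric decay and not only for a bound on the escape time. It comes from the indicator \<open>f\<close> of the
  bottleneck set, centred under the stationary law: a lazy reversible transition operator is positive
  semidefinite, so the autocovariances of \<open>f\<close> along the stationary chain are log-convex and decay no
  faster than geometrically, at the ratio of the first two of them, which is \<open>1 - \<delta>\<close> with \<open>\<delta>\<close> the
  normalized flow out of the set. On the other hand they are bounded by the total variation distance
  (\<open>tv_dist_lower_bound\<close>).\<close>

section \<open>Lazy reversible chains on a finite set\<close>

locale lazy_reversible_chain =
  fixes S :: "'a set" and P :: "'a \<Rightarrow> 'a \<Rightarrow> real" and \<pi> :: "'a \<Rightarrow> real"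
  assumes finite_S: "finite S"
    and \<pi>_nonneg: "x \<in> S \<Longrightarrow> 0 \<le> \<pi> x"
    and \<pi>_sum: "(\<Sum>x\<in>S. \<pi> x) = 1"
    and P_nonneg: "x \<in> S \<Longrightarrow> y \<in> S \<Longrightarrow> 0 \<le> P x y"
    and P_sum: "x \<in> S \<Longrightarrow> (\<Sum>y\<in>S. P x y) = 1"
    and reversible: "x \<in> S \<Longrightarrow> y \<in> S \<Longrightarrow> \<pi> x * P x y = \<pi> y * P y x"
    and lazy: "x \<in> S \<Longrightarrow> 1/2 \<le> P x x"
begin

definition transition :: "('a \<Rightarrow> real) \<Rightarrow> 'a \<Rightarrow> real" where
  "transition g x = (\<Sum>y\<in>S. P x y * g y)"

definition inner_\<pi> :: "('a \<Rightarrow> real) \<Rightarrow> ('a \<Rightarrow> real) \<Rightarrow> real" where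
  "inner_\<pi> g h = (\<Sum>x\<in>S. \<pi> x * g x * h x)"

lemma inner_\<pi>_commute: "inner_\<pi> g h = inner_\<pi> h g"
  by (simp add: inner_\<pi>_def mult_ac)

lemma inner_\<pi>_self_nonneg: "0 \<le> inner_\<pi> g g"
  unfolding inner_\<pi>_def by (intro sum_nonneg) (simp add: \<pi>_nonneg mult.assoc)

lemma inner_\<pi>_transition:
  "inner_\<pi> g (transition h) = (\<Sum>x\<in>S. \<Sum>y\<in>S. \<pi> x * P x y * g x * h y)"
  by (simp add: inner_\<pi>_def transition_def sum_distrib_left mult_ac)

lemma transition_self_adjoint: "inner_\<pi> g (transition h) = inner_\<pi> (transition g) h"
proof -
  have "inner_\<pi> g (transition h) = (\<Sum>x\<in>S. \<Sum>y\<in>S. \<pi> y * P y x * g x * h y)"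
    unfolding inner_\<pi>_transition by (intro sum.cong refl) (simp add: reversible)
  also have "\<dots> = (\<Sum>y\<in>S. \<Sum>x\<in>S. \<pi> y * P y x * h y * g x)"
    by (subst sum.swap) (simp add: mult_ac)
  also have "\<dots> = inner_\<pi> h (transition g)"
    by (simp add: inner_\<pi>_transition)
  finally show ?thesis by (simp add: inner_\<pi>_commute)
qed

text \<open>Expand the nonnegative form \<open>\<Sum> \<pi>(x) P(x,y) (g(x) + g(y))\<^sup>2\<close>: it equals twice the norm of \<open>g\<close> plus twice
  the form in question, while by laziness its diagonal alone is at least twice the norm of \<open>g\<close>.\<close>

lemma transition_positive: "0 \<le> inner_\<pi> g (transition g)"
proof -
  have row: "(\<Sum>x\<in>S. \<Sum>y\<in>S. \<pi> x * P x y * (g x)\<^sup>2) = inner_\<pi> g g"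
  proof -
    have "(\<Sum>y\<in>S. \<pi> x * P x y * (g x)\<^sup>2) = \<pi> x * g x * g x" if "x \<in> S" for x
    proof -
      have "(\<Sum>y\<in>S. \<pi> x * P x y * (g x)\<^sup>2) = \<pi> x * (g x)\<^sup>2 * (\<Sum>y\<in>S. P x y)"
        by (simp add: sum_distrib_left sum_distrib_right mult.assoc mult.commute mult.left_commute)
      then show ?thesis using P_sum[OF that] by (simp add: power2_eq_square)
    qed
    then show ?thesis by (simp add: inner_\<pi>_def)
  qed
  have "(\<Sum>x\<in>S. \<Sum>y\<in>S. \<pi> x * P x y * (g y)\<^sup>2)
      = (\<Sum>x\<in>S. \<Sum>y\<in>S. \<pi> y * P y x * (g y)\<^sup>2)"
    by (intro sum.cong refl) (simp add: reversible)
  also have "\<dots> = inner_\<pi> g g" by (subst sum.swap) (rule row)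
  finally have column: "(\<Sum>x\<in>S. \<Sum>y\<in>S. \<pi> x * P x y * (g y)\<^sup>2) = inner_\<pi> g g" .
  have square: "\<pi> x * P x y * (g x + g y)\<^sup>2
      = \<pi> x * P x y * (g x)\<^sup>2 + \<pi> x * P x y * (g y)\<^sup>2 + 2 * (\<pi> x * P x y * g x * g y)" for x y
    by (simp add: power2_eq_square algebra_simps)
  have "(\<Sum>x\<in>S. \<Sum>y\<in>S. \<pi> x * P x y * (g x + g y)\<^sup>2)
      = 2 * inner_\<pi> g g + 2 * inner_\<pi> g (transition g)"
    unfolding square sum.distrib row column
    by (simp add: inner_\<pi>_transition sum_distrib_left)
  moreover have "2 * inner_\<pi> g g \<le> (\<Sum>x\<in>S. \<Sum>y\<in>S. \<pi> x * P x y * (g x + g y)\<^sup>2)"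
  proof -
    have "2 * (\<pi> x * g x * g x) \<le> (\<Sum>y\<in>S. \<pi> x * P x y * (g x + g y)\<^sup>2)" if x: "x \<in> S" for x
    proof -
      have "(\<pi> x * (2 * g x)\<^sup>2) * (1/2) \<le> (\<pi> x * (2 * g x)\<^sup>2) * P x x"
        using lazy[OF x] \<pi>_nonneg[OF x] by (intro mult_left_mono) auto
      then have "2 * (\<pi> x * g x * g x) \<le> \<pi> x * P x x * (g x + g x)\<^sup>2"
        by (simp add: power2_eq_square mult_ac)
      also have "\<dots> \<le> (\<Sum>y\<in>S. \<pi> x * P x y * (g x + g y)\<^sup>2)"
        using x \<pi>_nonneg P_nonneg by (intro member_le_sum) (auto simp: finite_S)
      finally show ?thesis .
    qed
    then show ?thesis by (simp add: inner_\<pi>_def sum_distrib_left sum_mono)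
  qed
  ultimately show ?thesis by simp
qed

lemma transition_linear: "transition (\<lambda>x. g x + s * h x) = (\<lambda>x. transition g x + s * transition h x)"
  by (auto simp: transition_def algebra_simps sum.distrib sum_distrib_left)

lemma inner_\<pi>_linear: "inner_\<pi> (\<lambda>x. g x + s * h x) k = inner_\<pi> g k + s * inner_\<pi> h k"
  by (simp add: inner_\<pi>_def algebra_simps sum.distrib sum_distrib_left)

lemma inner_\<pi>_linear_right: "inner_\<pi> k (\<lambda>x. g x + s * h x) = inner_\<pi> k g + s * inner_\<pi> k h"
  by (simp add: inner_\<pi>_def algebra_simps sum.distrib sum_distrib_left)

text \<open>For centred \<open>f\<close> this is the covariance of \<open>f(X\<^sub>0)\<close> and \<open>f(X\<^sub>t)\<close> under the stationary chain.\<close>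

definition autocovariance :: "('a \<Rightarrow> real) \<Rightarrow> nat \<Rightarrow> real" where
  "autocovariance f t = inner_\<pi> f ((transition ^^ t) f)"

lemma inner_\<pi>_transition_pow:
  "inner_\<pi> ((transition ^^ s) f) ((transition ^^ t) f) = autocovariance f (s + t)"
proof (induction s arbitrary: t)
  case 0
  then show ?case by (simp add: autocovariance_def)
next
  case (Suc s)
  have "inner_\<pi> ((transition ^^ Suc s) f) ((transition ^^ t) f)
      = inner_\<pi> ((transition ^^ s) f) ((transition ^^ Suc t) f)"
    by (simp add: transition_self_adjoint)
  then show ?case using Suc[of "Suc t"] by simp
qed

text \<open>Cauchy-Schwarz for the iterates of \<open>f\<close>. Self-adjointness splits the time \<open>m\<close> evenly between
  both arguments; for even \<open>m\<close> this leaves the form \<open>\<langle>u,u\<rangle>\<close>, for odd \<open>m\<close> the form \<open>\<langle>u,Pu\<rangle>\<close>, and both are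
  positive semidefinite. The inequality is the discriminant condition for the quadratic polynomial in
  \<open>r\<close> that arises from \<open>u = P\<^sup>s f + r P\<^sup>s\<^sup>+\<^sup>1 f\<close>.\<close>

lemma autocovariance_log_convex:
  "(autocovariance f (Suc m))\<^sup>2 \<le> autocovariance f m * autocovariance f (Suc (Suc m))"
proof -
  define s where "s = m div 2"
  define a where "a = autocovariance f"
  let ?g = "(transition ^^ s) f" and ?h = "(transition ^^ Suc s) f"
  have nonneg: "0 \<le> a m + 2 * r * a (Suc m) + r\<^sup>2 * a (Suc (Suc m))" for r
  proof -
    let ?u = "\<lambda>x. ?g x + r * ?h x"
    show ?thesis
    proof (cases "even m")
      case True
      then have m: "m = s + s" by (auto simp: s_def)
      have "inner_\<pi> ?u ?u = a m + 2 * r * a (Suc m) + r\<^sup>2 * a (Suc (Suc m))"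
        by (simp only: inner_\<pi>_linear inner_\<pi>_linear_right inner_\<pi>_transition_pow)
          (simp add: a_def m power2_eq_square algebra_simps)
      then show ?thesis using inner_\<pi>_self_nonneg[of ?u] by simp
    next
      case False
      then have m: "m = Suc (s + s)" unfolding s_def by presburger
      have u: "transition ?u = (\<lambda>x. (transition ^^ Suc s) f x + r * (transition ^^ Suc (Suc s)) f x)"
        by (simp add: transition_linear)
      have "inner_\<pi> ?u (transition ?u) = a m + 2 * r * a (Suc m) + r\<^sup>2 * a (Suc (Suc m))"
        unfolding u
        by (simp only: inner_\<pi>_linear inner_\<pi>_linear_right inner_\<pi>_transition_pow)
          (simp add: a_def m power2_eq_square algebra_simps)
      then show ?thesis using transition_positive[of ?u] by simp
    qed
  qed
  let ?x = "a m" and ?y = "a (Suc m)" and ?z = "a (Suc (Suc m))"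
  have z: "0 \<le> ?z"
  proof (cases "even m")
    case True
    then have "Suc (Suc m) = Suc s + Suc s" by (auto simp: s_def)
    then have "?z = inner_\<pi> ?h ?h" by (simp only: a_def inner_\<pi>_transition_pow)
    then show ?thesis by (simp add: inner_\<pi>_self_nonneg)
  next
    case False
    then have "Suc (Suc m) = Suc s + Suc (Suc s)" unfolding s_def by presburger
    then have "?z = inner_\<pi> ?h (transition ?h)"
      using inner_\<pi>_transition_pow[of "Suc s" f "Suc (Suc s)"] by (simp add: a_def)
    then show ?thesis by (simp only: transition_positive)
  qed
  have "?y\<^sup>2 \<le> ?x * ?z"
  proof (cases "?z = 0")
    case True
    have "?y = 0"
    proof (rule ccontr)
      assume y: "?y \<noteq> 0"
      have "0 \<le> ?x + 2 * (- (?x + 1) / (2 * ?y)) * ?y"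
        using nonneg[of "- (?x + 1) / (2 * ?y)"] True by simp
      also have "\<dots> = -1" using y by (simp add: field_simps)
      finally show False by simp
    qed
    then show ?thesis using True by simp
  next
    case False
    then have z': "?z > 0" using z by simp
    have "0 \<le> ?x + 2 * (- ?y / ?z) * ?y + (- ?y / ?z)\<^sup>2 * ?z" by (rule nonneg)
    also have "\<dots> = ?x - ?y\<^sup>2 / ?z" using z' by (simp add: field_simps power2_eq_square)
    finally show ?thesis using z' by (simp add: field_simps)
  qed
  then show ?thesis by (simp add: a_def)
qed

text \<open>Log-convexity makes the ratio of consecutive autocovariances nondecreasing, so the first ratio
  bounds all of them from below.\<close>

lemma autocovariance_geometric:
  assumes "0 < autocovariance f 0" "0 < \<rho>" "\<rho> * autocovariance f 0 \<le> autocovariance f 1"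
  shows "\<rho> ^ t * autocovariance f 0 \<le> autocovariance f t"
proof -
  define a where "a = autocovariance f"
  have step: "0 < a t \<and> \<rho> * a t \<le> a (Suc t)" for t
  proof (induction t)
    case 0
    then show ?case using assms by (simp add: a_def)
  next
    case (Suc t)
    then have pos: "0 < a (Suc t)" using mult_pos_pos[of \<rho> "a t"] assms(2) by linarith
    have "(\<rho> * a t) * a (Suc t) \<le> a (Suc t) * a (Suc t)"
      using Suc pos by (intro mult_right_mono) auto
    also have "\<dots> \<le> a t * a (Suc (Suc t))"
      using autocovariance_log_convex[of f t] by (simp add: a_def power2_eq_square)
    finally have "a t * (\<rho> * a (Suc t)) \<le> a t * a (Suc (Suc t))" by (simp add: mult_ac)
    then show ?case using Suc pos by simp
  qed
  have "\<rho> ^ t * a 0 \<le> a t"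
  proof (induction t)
    case (Suc t)
    then have "\<rho> * (\<rho> ^ t * a 0) \<le> \<rho> * a t" using assms(2) by simp
    also have "\<dots> \<le> a (Suc t)" using step by simp
    finally show ?case by (simp add: mult_ac)
  qed simp
  then show ?thesis by (simp add: a_def)
qed

definition escape_flow :: "'a set \<Rightarrow> real" where
  "escape_flow A = (\<Sum>x\<in>A. \<Sum>y\<in>S - A. \<pi> x * P x y)"

lemma transition_pow_eq_sum:
  assumes "x \<in> S"
  shows "(transition ^^ t) g x = (\<Sum>y\<in>S. kernel_pow S P t x y * g y)"
  using assms
proof (induction t arbitrary: x)
  case 0
  then show ?case by (simp add: finite_S if_distrib[of "\<lambda>c. c * _"] cong: if_cong)
next
  case (Suc t)
  have "(transition ^^ Suc t) g x = (\<Sum>z\<in>S. \<Sum>y\<in>S. P x z * (kernel_pow S P t z y * g y))"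
    using Suc by (simp add: transition_def[of "(transition ^^ t) g"] sum_distrib_left)
  also have "\<dots> = (\<Sum>y\<in>S. \<Sum>z\<in>S. P x z * (kernel_pow S P t z y * g y))" by (rule sum.swap)
  also have "\<dots> = (\<Sum>y\<in>S. kernel_pow S P (Suc t) x y * g y)"
    by (simp add: sum_distrib_left mult_ac)
  finally show ?case .
qed

lemma kernel_pow_sum: "x \<in> S \<Longrightarrow> (\<Sum>y\<in>S. kernel_pow S P t x y) = 1"
proof (induction t arbitrary: x)
  case 0
  then show ?case by (simp add: finite_S)
next
  case (Suc t)
  have "(\<Sum>y\<in>S. kernel_pow S P (Suc t) x y) = (\<Sum>z\<in>S. \<Sum>y\<in>S. P x z * kernel_pow S P t z y)"
    by simp (rule sum.swap)
  also have "\<dots> = (\<Sum>z\<in>S. P x z)" using Suc.IH by (simp flip: sum_distrib_left)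
  finally show ?case using P_sum Suc.prems by simp
qed

lemma tv_dist_ge:
  assumes "A \<subseteq> S"
  shows "\<bar>(\<Sum>x\<in>A. \<mu> x) - (\<Sum>x\<in>A. \<nu> x)\<bar> \<le> tv_dist S \<mu> \<nu>"
  unfolding tv_dist_def using assms finite_S by (intro Max_ge) auto

text \<open>The test function is \<open>f = 1\<^sub>A - \<pi>(A)\<close>. At time \<open>t\<close> its image at \<open>x\<close> is \<open>P\<^sup>t(x,A) - \<pi>(A)\<close>, which total
  variation controls, so that the autocovariance is at most \<open>\<epsilon>\<close> times the mean of \<open>\<bar>f\<bar>\<close>, which is
  \<open>2 \<pi>(A) (1 - \<pi>(A))\<close>, twice the variance of \<open>f\<close>. The first autocovariance is the variance minus the
  escape flow.\<close>

lemma tv_dist_lower_bound: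
  assumes A: "A \<subseteq> S" and pos: "0 < sum \<pi> A" "sum \<pi> A < 1"
    and d: "d < 1" "escape_flow A \<le> d * (sum \<pi> A * (1 - sum \<pi> A))"
    and tv: "\<And>x. x \<in> S \<Longrightarrow> tv_dist S (kernel_pow S P t x) \<pi> \<le> \<epsilon>"
  shows "(1 - d) ^ t \<le> 2 * \<epsilon>"
proof -
  define q where "q = sum \<pi> A"
  define f :: "'a \<Rightarrow> real" where "f x = indicator A x - q" for x
  have sum_ind: "(\<Sum>x\<in>S. indicator A x * h x) = (\<Sum>x\<in>A. h x)" for h :: "'a \<Rightarrow> real"
    using A finite_S by (simp add: indicator_def if_distrib[of "\<lambda>c. c * _"] sum.If_cases Int_absorb1
        cong: if_cong)
  have pow_f: "(transition ^^ t) f x = (\<Sum>y\<in>A. kernel_pow S P t x y) - q" if x: "x \<in> S" for x t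
  proof -
    have "(transition ^^ t) f x = (\<Sum>y\<in>S. indicator A y * kernel_pow S P t x y)
        - q * (\<Sum>y\<in>S. kernel_pow S P t x y)"
      unfolding transition_pow_eq_sum[OF x]
      by (simp add: f_def algebra_simps sum_subtractf sum_distrib_left)
    then show ?thesis by (simp add: sum_ind kernel_pow_sum x)
  qed
  have inner_f: "inner_\<pi> f h = (\<Sum>x\<in>A. \<pi> x * h x) - q * (\<Sum>x\<in>S. \<pi> x * h x)" for h
  proof -
    have "inner_\<pi> f h = (\<Sum>x\<in>S. indicator A x * (\<pi> x * h x)) - q * (\<Sum>x\<in>S. \<pi> x * h x)"
      by (simp add: inner_\<pi>_def f_def algebra_simps sum_subtractf sum_distrib_left)
    then show ?thesis by (simp add: sum_ind)
  qed
  have mean_f: "(\<Sum>x\<in>S. \<pi> x * f x) = 0"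
    using sum_ind[of \<pi>]
    by (simp add: f_def right_diff_distrib sum_subtractf \<pi>_sum mult.commute q_def
        flip: sum_distrib_right)
  have mean_f_A: "(\<Sum>x\<in>A. \<pi> x * f x) = q * (1 - q)"
    by (simp add: f_def q_def algebra_simps sum_subtractf sum_distrib_left)
  have a0: "autocovariance f 0 = q * (1 - q)"
    by (simp add: autocovariance_def inner_f mean_f mean_f_A)
  have a1: "autocovariance f 1 = q * (1 - q) - escape_flow A"
  proof -
    have flow: "\<pi> x * f x - \<pi> x * transition f x = (\<Sum>y\<in>S - A. \<pi> x * P x y)" if x: "x \<in> A" for x
    proof -
      have "x \<in> S" using x A by auto
      have "transition f x = (\<Sum>y\<in>S. indicator A y * P x y) - q * (\<Sum>y\<in>S. P x y)"
        by (simp add: transition_def f_def algebra_simps sum_subtractf sum_distrib_left)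
      also have "\<dots> = (\<Sum>y\<in>A. P x y) - q" using P_sum[OF \<open>x \<in> S\<close>] by (simp add: sum_ind)
      also have "\<dots> = (1 - (\<Sum>y\<in>S - A. P x y)) - q"
        using P_sum[OF \<open>x \<in> S\<close>] sum.subset_diff[OF A finite_S, of "P x"] by simp
      finally have "transition f x = 1 - (\<Sum>y\<in>S - A. P x y) - q" .
      then show ?thesis using x
        by (simp add: f_def right_diff_distrib flip: sum_distrib_left)
    qed
    have "(\<Sum>x\<in>S. \<pi> x * transition f x) = inner_\<pi> (\<lambda>_. 1) (transition f)"
      by (simp add: inner_\<pi>_def)
    also have "\<dots> = (\<Sum>x\<in>S. \<pi> x * f x)"
      unfolding transition_self_adjoint
      by (simp add: inner_\<pi>_def transition_def P_sum)
    finally have "(\<Sum>x\<in>S. \<pi> x * transition f x) = 0" using mean_f by simp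
    then have "autocovariance f 1 = (\<Sum>x\<in>A. \<pi> x * transition f x)"
      by (simp add: autocovariance_def inner_f)
    also have "\<dots> = (\<Sum>x\<in>A. \<pi> x * f x) - escape_flow A"
      proof -
      have "escape_flow A = (\<Sum>x\<in>A. \<pi> x * f x - \<pi> x * transition f x)"
        unfolding escape_flow_def by (rule sum.cong[OF refl flow[symmetric]])
      then show ?thesis by (simp add: sum_subtractf)
    qed
    finally show ?thesis by (simp add: mean_f_A)
  qed
  have q: "0 < q" "q < 1" using pos by (auto simp: q_def)
  have "(1 - d) ^ t * (q * (1 - q)) \<le> autocovariance f t"
    using autocovariance_geometric[of f "1 - d" t] q d
    by (simp add: a0 a1[simplified] algebra_simps q_def)
  also have "\<dots> \<le> (\<Sum>x\<in>S. \<pi> x * \<bar>f x\<bar> * \<epsilon>)"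
    unfolding autocovariance_def inner_\<pi>_def
  proof (intro sum_mono)
    fix x assume x: "x \<in> S"
    have "\<bar>(transition ^^ t) f x\<bar> \<le> \<epsilon>"
      using tv_dist_ge[OF A, of "kernel_pow S P t x" \<pi>] tv[OF x] by (simp add: pow_f x q_def)
    then have "\<bar>f x\<bar> * \<bar>(transition ^^ t) f x\<bar> \<le> \<bar>f x\<bar> * \<epsilon>" by (intro mult_left_mono) auto
    then have "f x * (transition ^^ t) f x \<le> \<bar>f x\<bar> * \<epsilon>"
      using abs_ge_self[of "f x * (transition ^^ t) f x"] by (simp add: abs_mult)
    then show "\<pi> x * f x * (transition ^^ t) f x \<le> \<pi> x * \<bar>f x\<bar> * \<epsilon>"
      using \<pi>_nonneg[OF x] by (simp add: mult.assoc mult_left_mono)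
  qed
  also have "\<dots> = (2 * \<epsilon>) * (q * (1 - q))"
  proof -
    have abs_f: "\<bar>f x\<bar> = indicator A x * (1 - 2 * q) + q" for x
      using q by (auto simp: f_def indicator_def)
    have "(\<Sum>x\<in>S. \<pi> x * \<bar>f x\<bar>) = (\<Sum>x\<in>S. indicator A x * (\<pi> x * (1 - 2 * q))) + (\<Sum>x\<in>S. \<pi> x) * q"
      unfolding abs_f sum_distrib_right sum.distrib[symmetric]
      by (intro sum.cong refl) (simp add: algebra_simps)
    also have "\<dots> = 2 * (q * (1 - q))"
      unfolding sum_ind sum_distrib_right[symmetric] \<pi>_sum q_def[symmetric]
      by (simp add: algebra_simps)
    finally show ?thesis by (simp flip: sum_distrib_right)
  qed
  finally have "(1 - d) ^ t * (q * (1 - q)) \<le> (2 * \<epsilon>) * (q * (1 - q))" .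
  then show ?thesis using q by (simp add: mult_le_cancel_right)
qed

text \<open>Logarithms in the previous bound, with \<open>- ln (1 - d) \<le> d / (1 - d)\<close>.\<close>

lemma mixing_time_lower_bound:
  assumes A: "A \<subseteq> S" and pos: "0 < sum \<pi> A" "sum \<pi> A < 1"
    and d: "0 < d" "d < 1" "escape_flow A \<le> d * (sum \<pi> A * (1 - sum \<pi> A))"
    and tv: "\<And>x. x \<in> S \<Longrightarrow> tv_dist S (kernel_pow S P t x) \<pi> \<le> \<epsilon>"
    and \<epsilon>: "0 < \<epsilon>"
  shows "ln (1 / (2 * \<epsilon>)) * (1 / d - 1) \<le> real t"
proof -
  have "(1 - d) ^ t \<le> 2 * \<epsilon>" using tv_dist_lower_bound[OF A pos d(2,3) tv] .
  then have "ln ((1 - d) ^ t) \<le> ln (2 * \<epsilon>)" using d \<epsilon> by (subst ln_le_cancel_iff) auto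
  then have "real t * ln (1 - d) \<le> - ln (1 / (2 * \<epsilon>))"
    using d \<epsilon> by (simp add: ln_realpow ln_div ln_mult)
  moreover have "- ln (1 - d) \<le> d / (1 - d)"
  proof -
    have "ln (1 / (1 - d)) \<le> 1 / (1 - d) - 1" using d by (intro ln_le_minus_one) auto
    also have "\<dots> = d / (1 - d)" using d by (simp add: field_simps)
    finally show ?thesis using d by (simp add: ln_div)
  qed
  then have "real t * (- ln (1 - d)) \<le> real t * (d / (1 - d))" by (intro mult_left_mono) auto
  ultimately have "ln (1 / (2 * \<epsilon>)) \<le> real t * (d / (1 - d))" by simp
  then have "ln (1 / (2 * \<epsilon>)) * ((1 - d) / d) \<le> real t * (d / (1 - d)) * ((1 - d) / d)"
    using d by (intro mult_right_mono) auto
  moreover have "real t * (d / (1 - d)) * ((1 - d) / d) = real t" "(1 - d) / d = 1 / d - 1"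
    using d by (simp, simp add: diff_divide_distrib)
  ultimately show ?thesis by simp
qed

end

text \<open>In this form the event that the mixing time exceeds \<open>r\<close> is a countable Boolean combination of
  conditions on distances at fixed times, which is what its measurability is read off from.\<close>

lemma mixing_time_greater_iff:
  assumes S: "finite S" "S \<noteq> {}"
  shows "ereal r < ereal_of_enat (mixing_time S P \<mu> \<epsilon>) \<longleftrightarrow>
    (\<exists>x\<in>S. \<forall>t. 1 \<le> t \<and> (\<forall>t'\<ge>t. tv_dist S (kernel_pow S P t' x) \<mu> \<le> \<epsilon>) \<longrightarrow> r < real t)"
proof -
  define G where "G x = {t. 1 \<le> t \<and> (\<forall>t'\<ge>t. tv_dist S (kernel_pow S P t' x) \<mu> \<le> \<epsilon>)}" for x
  have INF_gt: "ereal r < ereal_of_enat (INF t\<in>G x. enat t) \<longleftrightarrow> (\<forall>t\<in>G x. r < real t)" for x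
  proof (cases "G x = {}")
    case True
    then show ?thesis by (simp add: top_enat_def)
  next
    case False
    define m where "m = (LEAST t. t \<in> G x)"
    have m: "m \<in> G x" using False by (auto simp: m_def intro: LeastI)
    have min: "m \<le> t" if "t \<in> G x" for t unfolding m_def by (rule Least_le) (rule that)
    have "(INF t\<in>G x. enat t) = enat m"
      by (intro antisym INF_lower2[OF m] INF_greatest) (auto dest: min)
    then show ?thesis using m min by force
  qed
  have "mixing_time S P \<mu> \<epsilon> = (MAX x\<in>S. INF t\<in>G x. enat t)"
    by (simp add: mixing_time_def G_def)
  moreover have "ereal r < ereal_of_enat (MAX x\<in>S. INF t\<in>G x. enat t) \<longleftrightarrow>
      (\<exists>x\<in>S. ereal r < ereal_of_enat (INF t\<in>G x. enat t))"
  proof -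
    have mono: "mono ereal_of_enat" by (auto simp: mono_def)
    have "ereal_of_enat (MAX x\<in>S. INF t\<in>G x. enat t) = (MAX x\<in>S. ereal_of_enat (INF t\<in>G x. enat t))"
      using mono_Max_commute[OF mono, of "(\<lambda>x. INF t\<in>G x. enat t) ` S"] S by (simp add: image_image)
    then show ?thesis using S by (simp add: Max_gr_iff)
  qed
  ultimately show ?thesis by (simp add: INF_gt) (simp add: G_def)
qed

lemma mixing_time_greaterI:
  assumes S: "finite S" "S \<noteq> {}"
    and slow: "\<And>t. 1 \<le> t \<Longrightarrow> (\<And>x. x \<in> S \<Longrightarrow> tv_dist S (kernel_pow S P t x) \<mu> \<le> \<epsilon>) \<Longrightarrow> r < real t"
  shows "ereal r < ereal_of_enat (mixing_time S P \<mu> \<epsilon>)"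
proof (rule ccontr)
  assume "\<not> ?thesis"
  then have "\<forall>x\<in>S. \<exists>t. 1 \<le> t \<and> (\<forall>t'\<ge>t. tv_dist S (kernel_pow S P t' x) \<mu> \<le> \<epsilon>) \<and> \<not> r < real t"
    unfolding mixing_time_greater_iff[OF S] by blast
  then obtain T where T: "\<And>x. x \<in> S \<Longrightarrow> 1 \<le> T x"
    "\<And>x t'. x \<in> S \<Longrightarrow> T x \<le> t' \<Longrightarrow> tv_dist S (kernel_pow S P t' x) \<mu> \<le> \<epsilon>"
    "\<And>x. x \<in> S \<Longrightarrow> real (T x) \<le> r"
    by (metis not_less)
  define t where "t = Max (T ` S)"
  have "t \<in> T ` S" using S by (auto simp: t_def intro!: Max_in)
  moreover have "T x \<le> t" if "x \<in> S" for x using that S by (simp add: t_def)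
  ultimately show False using slow[of t] T by (metis imageE linorder_not_less)
qed

section \<open>Orthogonality of the Haar functions on the design\<close>

lemma div_eq_iff_block:
  fixes M :: nat
  assumes "0 < M"
  shows "j div M = q \<longleftrightarrow> q * M \<le> j \<and> j < (q + 1) * M"
proof -
  have "j div M = q \<longleftrightarrow> q \<le> j div M \<and> j div M < q + 1" by linarith
  then show ?thesis
    by (simp only: less_eq_div_iff_mult_less_eq[OF assms] div_less_iff_less_mult[OF assms])
qed

text \<open>The sign pattern of a Haar function on the grid, with the grid point \<open>i\<close> written as
  \<open>Suc j\<close>: the half-open dyadic intervals, closed on the right, become the blocks of constant
  \<open>j div M\<close>, where \<open>M\<close> is half the number of grid points in the support.\<close>

definition dyadic_sign :: "nat \<Rightarrow> nat \<Rightarrow> nat \<Rightarrow> real" where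
  "dyadic_sign M k j = (if j div M = 2 * k then 1 else 0) - (if j div M = 2 * k + 1 then 1 else 0)"

lemma haar_at_design_point:
  fixes l m k j :: nat
  assumes n: "n = 2 ^ (m + 1)" and l: "l \<le> m"
  shows "haar (Node l k) (real (Suc j) / real n) = 
    2 powr (real l / 2) * dyadic_sign (2 ^ (m - l)) k j"
proof -
  define M :: nat where "M = 2 ^ (m - l)"
  have M: "M > 0" by (simp add: M_def)
  have nM: "real n = 2 * 2 ^ l * real M"
    using l by (simp add: n M_def flip: power_add)
  have block: "j div M = q \<longleftrightarrow> q * M < Suc j \<and> Suc j \<le> (q + 1) * M" for q
    using div_eq_iff_block[OF M] by (simp add: less_Suc_eq_le Suc_le_eq)
  define z where "z = 2 ^ l * (real (Suc j) / real n) - real k"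
  have z: "z = real (Suc j) / (2 * real M) - real k"
    using nM M by (simp add: z_def)
  have 1: "z \<in> {0<..1/2} \<longleftrightarrow> j div M = 2 * k"
  proof -
    have "z \<in> {0<..1/2} \<longleftrightarrow> real (2 * k * M) < real (Suc j) \<and> real (Suc j) \<le> real ((2 * k + 1) * M)"
      using M by (auto simp: z field_simps)
    then show ?thesis unfolding block of_nat_less_iff of_nat_le_iff .
  qed
  have 2: "z \<in> {1/2<..1} \<longleftrightarrow> j div M = 2 * k + 1"
  proof -
    have "z \<in> {1/2<..1} \<longleftrightarrow> real ((2 * k + 1) * M) < real (Suc j) \<and> real (Suc j) \<le> real ((2 * k + 1 + 1) * M)"
      using M by (auto simp: z field_simps)
    then show ?thesis unfolding block of_nat_less_iff of_nat_le_iff .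
  qed
  show ?thesis
    unfolding haar.simps haar_mother_def z_def[symmetric] M_def[symmetric]
    using 1 2 by (simp add: indicator_def dyadic_sign_def)
qed

lemma card_block:
  fixes M :: nat
  assumes "0 < M" "(q + 1) * M \<le> n"
  shows "card {j\<in>{..<n}. j div M = q} = M"
proof -
  have "{j\<in>{..<n}. j div M = q} = {q * M..<(q + 1) * M}"
    using assms(2) by (auto simp: div_eq_iff_block[OF assms(1)])
  then show ?thesis by simp
qed

lemma dyadic_sign_support: "dyadic_sign M k j \<noteq> 0 \<Longrightarrow> j div M div 2 = k"
  by (auto simp: dyadic_sign_def split: if_splits)

lemma sum_dyadic_sign:
  fixes M :: nat
  assumes M: "0 < M" and n: "2 * (k + 1) * M \<le> n"
  shows "(\<Sum>j<n. dyadic_sign M k j) = 0" (is ?zero)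
    and "(\<Sum>j<n. (dyadic_sign M k j)\<^sup>2) = 2 * real M" (is ?square)
proof -
  have "(2 * k + 1) * M \<le> 2 * (k + 1) * M" "(2 * k + 1 + 1) * M \<le> 2 * (k + 1) * M" by simp_all
  then have "(2 * k + 1) * M \<le> n" "(2 * k + 1 + 1) * M \<le> n" using n by linarith+
  then have count: "card {j\<in>{..<n}. j div M = 2 * k} = M" "card {j\<in>{..<n}. j div M = 2 * k + 1} = M"
    using card_block[OF M] by blast+
  have ind: "(\<Sum>j<n. if j div M = q then 1 else 0) = real (card {j\<in>{..<n}. j div M = q})" for q
    by (simp add: sum.If_cases Int_def)
  show ?zero unfolding dyadic_sign_def sum_subtractf ind count by simp
  have "(dyadic_sign M k j)\<^sup>2 = (if j div M = 2 * k then 1 else 0) + (if j div M = 2 * k + 1 then 1 else 0)" for j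
    by (simp add: dyadic_sign_def)
  then show ?square by (simp only: sum.distrib ind count)
qed

text \<open>A function of \<open>j div (2 * M)\<close> is constant on the support of the sign pattern, where the pattern
  has mean zero.\<close>

lemma dyadic_sign_cancels_coarse:
  fixes M :: nat and F :: "nat \<Rightarrow> real"
  assumes "0 < M" "2 * (k + 1) * M \<le> n"
  shows "(\<Sum>j<n. F (j div (2 * M)) * dyadic_sign M k j) = 0"
proof -
  have "F (j div (2 * M)) * dyadic_sign M k j = F k * dyadic_sign M k j" for j
  proof -
    have "j div (2 * M) = j div M div 2" by (metis div_mult2_eq mult.commute)
    then show ?thesis using dyadic_sign_support[of M k j] by (cases "dyadic_sign M k j = 0") auto
  qed
  then have "(\<Sum>j<n. F (j div (2 * M)) * dyadic_sign M k j) = F k * (\<Sum>j<n. dyadic_sign M k j)"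
    by (simp only: sum_distrib_left)
  then show ?thesis using sum_dyadic_sign(1)[OF assms] by simp
qed

lemma dyadic_sign_coarsen:
  assumes "l' < l" "l \<le> m"
  shows "dyadic_sign (2 ^ (m - l')) k' j
    = dyadic_sign (2 ^ (l - l' - 1)) k' (j div (2 * 2 ^ (m - l)))"
proof -
  have "m - l' = Suc (m - l) + (l - l' - 1)" using assms by simp
  then have "(2::nat) ^ (m - l') = 2 * 2 ^ (m - l) * 2 ^ (l - l' - 1)"
    by (metis power_Suc power_add)
  then show ?thesis by (simp only: dyadic_sign_def div_mult2_eq)
qed

lemma Node_in_nodes [simp]: "Node l k \<in> nodes L \<longleftrightarrow> l < L \<and> k < 2 ^ l"
  by (simp add: nodes_def)

lemma Root_in_nodes [simp]: "Root \<in> nodes L"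
  by (simp add: nodes_def)

text \<open>The relation \<open>X'X = n I\<close>. Of two functions on different levels the coarser one is constant on the
  support of the finer one; on one level the supports are disjoint. All levels below \<open>m\<close> have
  support of at least four grid points, so both halves of each support are met equally often.\<close>

theorem haar_orthogonal:
  fixes n m :: nat
  assumes n: "n = 2 ^ (m + 1)" and v: "v \<in> nodes m" and u: "u \<in> nodes m"
  shows "(\<Sum>i\<in>{1..n}. haar v (real i / real n) * haar u (real i / real n)) = (if v = u then real n else 0)"
proof -
  let ?h = "\<lambda>v j. haar v (real (Suc j) / real n)"
  have fit: "2 * (k + 1) * 2 ^ (m - l) \<le> n" if "l < m" "k < 2 ^ l" for l k :: nat
  proof -
    have "2 * (k + 1) * 2 ^ (m - l) \<le> 2 * 2 ^ l * 2 ^ (m - l)"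
      using that by (intro mult_le_mono1 mult_le_mono2) simp
    also have "\<dots> = n" using that by (simp add: n flip: power_add)
    finally show ?thesis .
  qed
  have root: "?h Root j = 1" if "j < n" for j
    using that by simp
  \<comment> \<open>The root counts as coarser than every level.\<close>
  have coarse: "(\<Sum>j<n. ?h u j * ?h (Node l k) j) = 0"
    if l: "l < m" "k < 2 ^ l" and u: "u = Root \<or> (\<exists>l' k'. u = Node l' k' \<and> l' < l)" for l k u
  proof -
    obtain F where F: "\<And>j. j < n \<Longrightarrow> ?h u j = F (j div (2 * 2 ^ (m - l)))"
    proof (cases u)
      case Root
      show ?thesis by (rule that[of "\<lambda>_. 1"]) (unfold Root, rule root)
    next
      case (Node l' k')
      then have l': "l' < l" using u by auto
      show ?thesis
        using l l' by (intro that[of "\<lambda>q. 2 powr (real l' / 2) * dyadic_sign (2 ^ (l - l' - 1)) k' q"])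
          (simp only: Node haar_at_design_point[OF n] dyadic_sign_coarsen)
    qed
    have "(\<Sum>j<n. ?h u j * ?h (Node l k) j)
        = (\<Sum>j<n. 2 powr (real l / 2) * (F (j div (2 * 2 ^ (m - l))) * dyadic_sign (2 ^ (m - l)) k j))"
      using l by (intro sum.cong refl) (simp add: F haar_at_design_point[OF n] del: haar.simps of_nat_Suc)
    also have "\<dots> = 0"
      using dyadic_sign_cancels_coarse[OF _ fit[OF l], of F] by (simp flip: sum_distrib_left)
    finally show ?thesis .
  qed
  have level: "(\<Sum>j<n. ?h (Node l k) j * ?h (Node l k') j) = (if k = k' then real n else 0)"
    if l: "l < m" "k < 2 ^ l" for l k k'
  proof -
    have "(\<Sum>j<n. ?h (Node l k) j * ?h (Node l k') j)
        = (\<Sum>j<n. 2 ^ l * (dyadic_sign (2 ^ (m - l)) k j * dyadic_sign (2 ^ (m - l)) k' j))"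
    proof (intro sum.cong refl)
      fix j
      let ?s = "(2::real) powr (real l / 2)"
      let ?x = "dyadic_sign (2 ^ (m - l)) k j" and ?y = "dyadic_sign (2 ^ (m - l)) k' j"
      have "?s * ?s = 2 ^ l" by (simp add: powr_realpow flip: powr_add)
      moreover have "?h (Node l k) j * ?h (Node l k') j = (?s * ?x) * (?s * ?y)"
        using l by (simp only: haar_at_design_point[OF n, of l] less_imp_le)
      moreover have "(?s * ?x) * (?s * ?y) = (?s * ?s) * (?x * ?y)" by (simp only: mult_ac)
      ultimately show "?h (Node l k) j * ?h (Node l k') j = 2 ^ l * (?x * ?y)" by (simp only:)
    qed
    also have "\<dots> = (if k = k' then real n else 0)"
    proof (cases "k = k'")
      case True
      have "(2::nat) ^ l * 2 ^ (m - l) = 2 ^ m"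
        using l by (simp add: power_add[symmetric])
      then have "(2::nat) ^ l * (2 * 2 ^ (m - l)) = n" by (simp add: n mult.left_commute)
      then have "2 ^ l * (2 * real (2 ^ (m - l))) = real n"
        by (metis of_nat_mult of_nat_numeral of_nat_power)
      moreover have "(\<Sum>j<n. dyadic_sign (2 ^ (m - l)) k j * dyadic_sign (2 ^ (m - l)) k j)
          = 2 * real (2 ^ (m - l))"
        using sum_dyadic_sign(2)[OF _ fit[OF l]] by (simp add: power2_eq_square)
      ultimately show ?thesis using True by (simp only: sum_distrib_left[symmetric] simp_thms if_True)
    next
      case False
      have "dyadic_sign M k j * dyadic_sign M k' j = 0" for M j
        using False dyadic_sign_support[of M k j] dyadic_sign_support[of M k' j] by auto
      then show ?thesis using False by (simp only: mult_zero_right sum.neutral_const if_False)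
    qed
    finally show ?thesis .
  qed
  have "(\<Sum>i\<in>{1..n}. haar v (real i / real n) * haar u (real i / real n)) = (\<Sum>j<n. ?h v j * ?h u j)"
    by (simp only: One_nat_def sum.atLeast1_atMost_eq)
  also have "\<dots> = (if v = u then real n else 0)"
  proof (cases v)
    case Root
    show ?thesis
    proof (cases u)
      case (Node l k)
      then have "l < m" "k < 2 ^ l" using u by auto
      then show ?thesis using coarse[of l k v] Root Node by simp
    qed (simp add: Root root del: of_nat_Suc haar.simps)
  next
    case v': (Node l k)
    have v: "l < m" "k < 2 ^ l" using v v' by auto
    show ?thesis
    proof (cases u)
      case Root
      then show ?thesis using coarse[OF v, of u] v' by (simp add: mult.commute)
    next
      case u': (Node l' k')
      have u: "l' < m" "k' < 2 ^ l'" using u u' by auto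
      consider "l < l'" | "l' < l" | "l = l'" by linarith
      then show ?thesis
      proof cases
        case 1
        then show ?thesis using coarse[OF u, of v] v' u' by simp
      next
        case 2
        then show ?thesis using coarse[OF v, of u] v' u' by (simp add: mult.commute)
      next
        case 3
        then show ?thesis using level[OF v, of k'] v' u' by simp
      qed
    qed
  qed
  finally show ?thesis .
qed

section \<open>Closed form of the marginal likelihood\<close>

text \<open>The coordinate of \<open>X'Y\<close> that belongs to \<open>v\<close>.\<close>

definition score :: "nat \<Rightarrow> node \<Rightarrow> (nat \<Rightarrow> real) \<Rightarrow> real" where
  "score n v Y = (\<Sum>i\<in>{1..n}. haar v (real i / real n) * Y i)"

definition node_evidence :: "nat \<Rightarrow> (nat \<Rightarrow> real) \<Rightarrow> node \<Rightarrow> real" where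
  "node_evidence n Y v = exp ((score n v Y)\<^sup>2 / (2 * (1 + real n))) / sqrt (1 + real n)"

text \<open>Tilting the standard normal density of the \<open>i\<close>-th observation to the mean \<open>(X\<beta>)\<^sub>i\<close> contributes the
  exponential of \<open>Y'X\<beta> - \<beta>'X'X\<beta>/2\<close> in total, and by orthogonality the quadratic form is diagonal.\<close>

lemma likelihood_factorizes:
  fixes n m :: nat
  assumes n: "n = 2 ^ (m + 1)" and T: "T \<subseteq> nodes m" "finite T"
  shows "likelihood n T \<beta> Y = (\<Prod>i\<in>{1..n}. std_normal_density (Y i)) *
    (\<Prod>v\<in>T. exp (\<beta> v * score n v Y - real n * (\<beta> v)\<^sup>2 / 2))"
proof -
  let ?h = "\<lambda>v i. haar v (real i / real n)"
  let ?mean = "\<lambda>i. \<Sum>v\<in>T. ?h v i * \<beta> v"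
  have tilt: "normal_density \<mu> 1 y = std_normal_density y * exp (\<mu> * y - \<mu>\<^sup>2 / 2)" for \<mu> y
  proof -
    have e: "- (y - \<mu>)\<^sup>2 / (2 * 1\<^sup>2) = - (y - 0)\<^sup>2 / (2 * 1\<^sup>2) + (\<mu> * y - \<mu>\<^sup>2 / 2)"
      by (simp add: power2_eq_square algebra_simps) (simp add: field_simps)
    show ?thesis unfolding normal_density_def e exp_add by (simp only: mult.assoc)
  qed
  have linear: "(\<Sum>i\<in>{1..n}. ?mean i * Y i) = (\<Sum>v\<in>T. \<beta> v * score n v Y)"
    unfolding score_def sum_distrib_right sum_distrib_left
    by (subst sum.swap) (simp add: mult_ac)
  have "(\<Sum>i\<in>{1..n}. (?mean i)\<^sup>2) = (\<Sum>i\<in>{1..n}. \<Sum>v\<in>T. \<Sum>u\<in>T. \<beta> v * \<beta> u * (?h v i * ?h u i))"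
    by (simp add: power2_eq_square sum_product mult_ac)
  also have "\<dots> = (\<Sum>v\<in>T. \<Sum>u\<in>T. \<beta> v * \<beta> u * (\<Sum>i\<in>{1..n}. ?h v i * ?h u i))"
    by (simp only: sum_distrib_left sum.swap[of _ "{1..n}"])
  also have "\<dots> = (\<Sum>v\<in>T. \<Sum>u\<in>T. \<beta> v * \<beta> u * (if v = u then real n else 0))"
    using T by (intro sum.cong refl) (simp only: haar_orthogonal[OF n] subset_eq)
  also have "\<dots> = (\<Sum>v\<in>T. real n * (\<beta> v)\<^sup>2)"
    using T by (simp add: if_distrib[of "\<lambda>c. _ * c"] power2_eq_square mult_ac cong: if_cong)
  finally have quadratic: "(\<Sum>i\<in>{1..n}. (?mean i)\<^sup>2) = (\<Sum>v\<in>T. real n * (\<beta> v)\<^sup>2)" .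
  have "likelihood n T \<beta> Y
      = (\<Prod>i\<in>{1..n}. std_normal_density (Y i) * exp (?mean i * Y i - (?mean i)\<^sup>2 / 2))"
    unfolding likelihood_def by (intro prod.cong refl tilt)
  also have "\<dots> = (\<Prod>i\<in>{1..n}. std_normal_density (Y i)) *
      exp (\<Sum>i\<in>{1..n}. ?mean i * Y i - (?mean i)\<^sup>2 / 2)"
    by (simp only: prod.distrib exp_sum finite_atLeastAtMost)
  also have "(\<Sum>i\<in>{1..n}. ?mean i * Y i - (?mean i)\<^sup>2 / 2)
      = (\<Sum>v\<in>T. \<beta> v * score n v Y - real n * (\<beta> v)\<^sup>2 / 2)"
    by (simp only: sum_subtractf linear quadratic sum_divide_distrib[symmetric])
  finally show ?thesis by (simp only: exp_sum T)
qed

text \<open>Completing the square: with the tilt, the standard normal density is a multiple of the density of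
  the conjugate posterior, the normal law with mean \<open>g/(1+n)\<close> and variance \<open>1/(1+n)\<close>.\<close>

lemma gaussian_tilt:
  fixes g :: real and n :: nat
  defines "D \<equiv> density lborel std_normal_density"
  shows "integrable D (\<lambda>b. exp (b * g - real n * b\<^sup>2 / 2))"
    and "(\<integral>b. exp (b * g - real n * b\<^sup>2 / 2) \<partial>D) = exp (g\<^sup>2 / (2 * (1 + real n))) / sqrt (1 + real n)"
proof -
  let ?C = "exp (g\<^sup>2 / (2 * (1 + real n))) / sqrt (1 + real n)"
  have complete_square: "std_normal_density b *\<^sub>R exp (b * g - real n * b\<^sup>2 / 2)
      = ?C * normal_density (g / (1 + real n)) (1 / sqrt (1 + real n)) b" for b
  proof -
    have N: "1 + real n > 0" by simp
    have e: "- b\<^sup>2 / 2 + (b * g - real n * b\<^sup>2 / 2)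
        = g\<^sup>2 / (2 * (1 + real n)) + - (b - g / (1 + real n))\<^sup>2 * (1 + real n) / 2"
    proof -
      have "(b - g / N)\<^sup>2 * N = b\<^sup>2 * N - 2 * b * g + g\<^sup>2 / N" if "N > 0" for N :: real
        using that by (simp add: field_simps power2_eq_square)
      from this[OF N] have "- (b - g / (1 + real n))\<^sup>2 * (1 + real n) / 2
          = - (b\<^sup>2 * (1 + real n) - 2 * b * g + g\<^sup>2 / (1 + real n)) / 2"
        by simp
      moreover have "g\<^sup>2 / (2 * (1 + real n)) = g\<^sup>2 / (1 + real n) / 2" by simp
      ultimately show ?thesis by (simp only:) (simp add: algebra_simps add_divide_distrib diff_divide_distrib)
    qed
    have "std_normal_density b *\<^sub>R exp (b * g - real n * b\<^sup>2 / 2)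
        = 1 / sqrt (2 * pi) * exp (- b\<^sup>2 / 2 + (b * g - real n * b\<^sup>2 / 2))"
      unfolding exp_add by (simp add: std_normal_density_def)
    also have "\<dots> = ?C * normal_density (g / (1 + real n)) (1 / sqrt (1 + real n)) b"
      unfolding e exp_add normal_density_def using N
      by (simp add: power_divide real_sqrt_divide mult.commute)
    finally show ?thesis .
  qed
  show "integrable D (\<lambda>b. exp (b * g - real n * b\<^sup>2 / 2))"
    unfolding D_def by (subst integrable_density) (simp_all add: complete_square del: real_scaleR_def)
  show "(\<integral>b. exp (b * g - real n * b\<^sup>2 / 2) \<partial>D) = ?C"
    unfolding D_def by (subst integral_density) (simp_all add: complete_square del: real_scaleR_def)
qed

text \<open>Both the likelihood and the prior of the coefficients are products over the nodes, so the integral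
  splits into one-dimensional Gaussian integrals.\<close>

theorem marginal_likelihood_factorizes:
  fixes n m :: nat
  assumes n: "n = 2 ^ (m + 1)" and T: "T \<subseteq> nodes m" "finite T"
  shows "marginal_likelihood n T Y =
    (\<Prod>i\<in>{1..n}. std_normal_density (Y i)) * (\<Prod>v\<in>T. node_evidence n Y v)"
proof -
  interpret D: prob_space "density lborel std_normal_density" by (rule prob_space_normal_density) simp
  interpret product_sigma_finite "\<lambda>_::node. density lborel std_normal_density" by standard
  show ?thesis
    unfolding marginal_likelihood_def likelihood_factorizes[OF n T]
    by (simp only: integral_mult_right_zero product_integral_prod[OF T(2) gaussian_tilt(1)]
        gaussian_tilt(2) node_evidence_def)
qed

section \<open>Trees and the Metropolis--Hastings chain\<close>

lemma nodes_eq: "nodes L = insert Root (\<Union>l<L. Node l ` {..<2 ^ l})"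
  by (auto simp: nodes_def)

lemma finite_nodes [simp]: "finite (nodes L)"
  by (simp add: nodes_eq)

lemma card_nodes: "card (nodes L) \<le> 2 ^ L"
proof (induction L)
  case 0
  then show ?case by (simp add: nodes_eq)
next
  case (Suc L)
  have "nodes (Suc L) = nodes L \<union> Node L ` {..<2 ^ L}" by (auto simp: nodes_def less_Suc_eq)
  then have "card (nodes (Suc L)) \<le> card (nodes L) + card (Node L ` {..<2 ^ L})"
    by (simp only: card_Un_le)
  also have "\<dots> \<le> 2 ^ L + 2 ^ L"
    using Suc card_image_le[of "{..<2 ^ L}" "Node L"] by (intro add_mono) auto
  finally show ?case by simp
qed

lemma nodes_mono: "L \<le> M \<Longrightarrow> nodes L \<subseteq> nodes M"
  by (auto simp: nodes_def)

lemma finite_trees [simp]: "finite (trees L)"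
  by (rule finite_subset[of _ "Pow (nodes L)"]) (auto simp: trees_def)

lemma tree_finite: "T \<in> trees L \<Longrightarrow> finite T"
  by (auto simp: trees_def intro: finite_subset)

lemma null_tree: "{Root} \<in> trees L"
  by (simp add: trees_def)

lemma finite_children [simp]: "finite (children v)"
  by (cases v) auto

lemma card_children: "card (children v) \<le> 2"
  by (cases v) (auto simp: card_insert_if)

lemma finite_ext_nodes: "finite T \<Longrightarrow> finite (ext_nodes T)"
  by (simp add: ext_nodes_def)

lemma card_ext_nodes:
  assumes "finite T"
  shows "card (ext_nodes T) \<le> 2 * card T"
proof -
  have "card (ext_nodes T) \<le> card (\<Union>v\<in>T. children v)"
    using assms by (intro card_mono) (auto simp: ext_nodes_def)
  also have "\<dots> \<le> (\<Sum>v\<in>T. card (children v))" by (rule card_UN_le[OF assms])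
  also have "\<dots> \<le> (\<Sum>v\<in>T. 2)" by (intro sum_mono card_children)
  finally show ?thesis by simp
qed

lemma finite_preterminal: "finite T \<Longrightarrow> finite (preterminal T)"
  by (simp add: preterminal_def)

text \<open>The common bound for GROW and PRUNE: both pick a point of a finite set uniformly and map it to the
  proposed tree.\<close>

lemma uniform_choice_sum_le_1:
  assumes "finite F" "finite E"
  shows "(\<Sum>U\<in>F. if \<exists>v\<in>E. U = g v then 1 / real (card E) else 0) \<le> 1"
proof -
  have "(\<Sum>U\<in>F. if \<exists>v\<in>E. U = g v then 1 / real (card E) else 0)
      = real (card {U\<in>F. \<exists>v\<in>E. U = g v}) / real (card E)"
    using assms(1) by (simp add: sum.If_cases Int_def)
  also have "\<dots> \<le> real (card (g ` E)) / real (card E)"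
    using assms by (intro divide_right_mono of_nat_mono card_mono) auto
  also have "\<dots> \<le> real (card E) / real (card E)"
    using assms by (intro divide_right_mono of_nat_mono card_image_le) auto
  also have "\<dots> \<le> 1" by simp
  finally show ?thesis .
qed

lemma grow_prob_bounds: "0 \<le> grow_prob L T" "grow_prob L T \<le> 1"
  by (simp_all add: grow_prob_def)

lemma proposal_nonneg: "0 \<le> proposal L T T'"
  unfolding proposal_def S_grow_def S_prune_def
  by (intro add_nonneg_nonneg mult_nonneg_nonneg) (simp_all add: grow_prob_bounds)

lemma proposal_sum_le_1:
  assumes "finite F" "finite T"
  shows "(\<Sum>U\<in>F. proposal L T U) \<le> 1"
proof -
  have "(\<Sum>U\<in>F. proposal L T U)
      = grow_prob L T * (\<Sum>U\<in>F. S_grow T U) + (1 - grow_prob L T) * (\<Sum>U\<in>F. S_prune T U)"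
    by (simp add: proposal_def sum.distrib sum_distrib_left)
  also have "\<dots> \<le> grow_prob L T * 1 + (1 - grow_prob L T) * 1"
    unfolding S_grow_def S_prune_def using assms grow_prob_bounds[of L T]
    by (intro add_mono mult_left_mono uniform_choice_sum_le_1 finite_ext_nodes finite_preterminal) auto
  finally show ?thesis by simp
qed

text \<open>Both sides equal the minimum of \<open>a * s\<close> and \<open>b * t\<close>. If one of the two proposal probabilities
  vanishes, the convention \<open>x / 0 = 0\<close> makes both acceptance terms vanish as well.\<close>

lemma metropolis_balance:
  fixes a b s t :: real
  assumes "0 < a" "0 < b" "0 \<le> s" "0 \<le> t"
  shows "a * (s * min 1 (b * t / (a * s))) = b * (t * min 1 (a * s / (b * t)))"
proof (cases "s = 0 \<or> t = 0")
  case False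
  then have "0 < s" "0 < t" using assms by auto
  then show ?thesis using assms by (simp add: min_def field_simps)
qed auto

lemma lazy_cart_chain:
  assumes pos: "\<And>T. T \<in> trees L \<Longrightarrow> 0 < posterior n L p Y T"
    and total: "(\<Sum>T\<in>trees L. posterior n L p Y T) = 1"
  shows "lazy_reversible_chain (trees L) (lazy_kernel n L p Y) (posterior n L p Y)"
proof
  let ?move = "\<lambda>T U. proposal L T U * acceptance n L p Y T U"
  have accept: "0 \<le> acceptance n L p Y T U" "acceptance n L p Y T U \<le> 1"
    if "T \<in> trees L" "U \<in> trees L" for T U
  proof -
    have "0 \<le> posterior n L p Y U * proposal L U T / (posterior n L p Y T * proposal L T U)"
      by (intro divide_nonneg_nonneg mult_nonneg_nonneg proposal_nonneg less_imp_le pos that)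
    then show "0 \<le> acceptance n L p Y T U" "acceptance n L p Y T U \<le> 1"
      by (simp_all add: acceptance_def)
  qed
  have off: "0 \<le> ?move T U" if "T \<in> trees L" "U \<in> trees L" for T U
    using accept that proposal_nonneg by (intro mult_nonneg_nonneg) auto
  have leave: "(\<Sum>U\<in>trees L - {T}. ?move T U) \<le> 1" if T: "T \<in> trees L" for T
  proof -
    have "(\<Sum>U\<in>trees L - {T}. ?move T U) \<le> (\<Sum>U\<in>trees L - {T}. proposal L T U)"
      using accept T proposal_nonneg by (intro sum_mono mult_left_le) auto
    also have "\<dots> \<le> 1" using T by (intro proposal_sum_le_1) (auto intro: tree_finite)
    finally show ?thesis .
  qed
  show "finite (trees L)" by simp
  show "(\<Sum>x\<in>trees L. posterior n L p Y x) = 1" by (rule total)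
  fix T assume T: "T \<in> trees L"
  show "0 \<le> posterior n L p Y T" using pos[OF T] by simp
  show "1/2 \<le> lazy_kernel n L p Y T T"
    using leave[OF T] by (simp add: lazy_kernel_def mh_kernel_def)
  show "(\<Sum>U\<in>trees L. lazy_kernel n L p Y T U) = 1"
  proof -
    have "(\<Sum>U\<in>trees L. mh_kernel n L p Y T U)
        = mh_kernel n L p Y T T + (\<Sum>U\<in>trees L - {T}. mh_kernel n L p Y T U)"
      by (rule sum.remove[OF finite_trees T])
    also have "(\<Sum>U\<in>trees L - {T}. mh_kernel n L p Y T U) = (\<Sum>U\<in>trees L - {T}. ?move T U)"
      by (intro sum.cong) (auto simp: mh_kernel_def)
    finally have "(\<Sum>U\<in>trees L. mh_kernel n L p Y T U) = 1" by (simp add: mh_kernel_def)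
    then show ?thesis using T
      by (simp add: lazy_kernel_def sum.distrib flip: sum_divide_distrib)
  qed
  fix U assume U: "U \<in> trees L"
  show "0 \<le> lazy_kernel n L p Y T U"
    using off[OF T U] leave[OF T] by (auto simp: lazy_kernel_def mh_kernel_def)
  show "posterior n L p Y T * lazy_kernel n L p Y T U = posterior n L p Y U * lazy_kernel n L p Y U T"
  proof (cases "U = T")
    case False
    then show ?thesis
      using metropolis_balance[OF pos[OF T] pos[OF U], of "proposal L T U" "proposal L U T"]
      by (simp add: lazy_kernel_def mh_kernel_def acceptance_def proposal_nonneg)
  qed simp
qed

text \<open>The leftmost path from the root through the levels below \<open>d\<close>, which the chain has to climb.\<close>

definition spine :: "nat \<Rightarrow> node set" where
  "spine d = insert Root ((\<lambda>l. Node l 0) ` {..<d})"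

lemma spine_tree: "spine L \<in> trees L"
  by (auto simp: spine_def trees_def)

lemma finite_spine [simp]: "finite (spine d)"
  by (simp add: spine_def)

lemma card_spine: "card (spine d) = d + 1"
  unfolding spine_def by (subst card_insert_disjoint) (auto simp: card_image inj_on_def)

lemma prod_spine: "(\<Prod>v\<in>spine d. q v) = q Root * (\<Prod>l<d. q (Node l 0))"
  unfolding spine_def by (subst prod.insert) (auto simp: prod.reindex inj_on_def)

lemma spine_subset_tree:
  assumes T: "T \<in> trees L" and d: "Node d 0 \<in> T"
  shows "spine (Suc d) \<subseteq> T"
proof -
  have step: "Node l 0 \<in> T" if "Node (Suc l) 0 \<in> T" for l
    using T that by (force simp: trees_def)
  have "Node l 0 \<in> T" if "l \<le> d" for l
    using that by (induction rule: inc_induct) (auto intro: d step)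
  then show ?thesis using T by (auto simp: spine_def trees_def)
qed

text \<open>A node can only become internal by a GROW move when it is external, that is, when its parent is
  already internal. This identifies the gate of the bottleneck.\<close>

lemma proposal_enters_deep_node:
  assumes "proposal L T U \<noteq> 0" "Node (Suc d) 0 \<notin> T" "Node (Suc d) 0 \<in> U"
  shows "Node d 0 \<in> T"
proof -
  have "S_prune T U = 0" using assms by (auto simp: S_prune_def)
  then have "S_grow T U \<noteq> 0" using assms(1) by (auto simp: proposal_def)
  then obtain v where v: "v \<in> ext_nodes T" "U = insert v T" by (auto simp: S_grow_def split: if_splits)
  then have "Node (Suc d) 0 \<in> ext_nodes T" using assms by auto
  then obtain u where u: "u \<in> T" "Node (Suc d) 0 \<in> children u" by (auto simp: ext_nodes_def)
  then have "u = Node d 0" by (cases u) auto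
  then show ?thesis using u by simp
qed

text \<open>Remove the common part \<open>B\<close> and enlarge the family to all subsets of \<open>N - B\<close>; their products sum
  to a product by expanding it. Forgetting the tree structure makes any counting of trees superfluous.\<close>

lemma sum_prod_between:
  fixes q :: "'a \<Rightarrow> real"
  assumes N: "finite N" "B \<subseteq> N" and F: "\<And>T. T \<in> F \<Longrightarrow> B \<subseteq> T \<and> T \<subseteq> N"
    and q: "\<And>v. v \<in> N \<Longrightarrow> 0 \<le> q v"
  shows "(\<Sum>T\<in>F. \<Prod>v\<in>T. q v) \<le> (\<Prod>v\<in>B. q v) * (\<Prod>v\<in>N - B. 1 + q v)"
proof -
  have F': "F \<subseteq> (\<lambda>S. B \<union> S) ` Pow (N - B)"
  proof
    fix T assume "T \<in> F"
    then have "T = B \<union> (T - B)" "T - B \<in> Pow (N - B)" using F by auto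
    then show "T \<in> (\<lambda>S. B \<union> S) ` Pow (N - B)" by blast
  qed
  have inj: "inj_on (\<lambda>S. B \<union> S) (Pow (N - B))" by (auto simp: inj_on_def)
  have fin: "finite B" "finite (N - B)" using N by (auto intro: finite_subset)
  have "(\<Sum>T\<in>F. \<Prod>v\<in>T. q v) \<le> (\<Sum>T\<in>(\<lambda>S. B \<union> S) ` Pow (N - B). \<Prod>v\<in>T. q v)"
    using F' fin N q by (intro sum_mono2) (auto intro!: prod_nonneg)
  also have "\<dots> = (\<Sum>S\<in>Pow (N - B). \<Prod>v\<in>B \<union> S. q v)" by (simp add: sum.reindex[OF inj])
  also have "\<dots> = (\<Sum>S\<in>Pow (N - B). (\<Prod>v\<in>B. q v) * (\<Prod>v\<in>S. q v))"
    using fin by (intro sum.cong refl prod.union_disjoint) (auto intro: finite_subset)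
  also have "\<dots> = (\<Prod>v\<in>B. q v) * (\<Sum>S\<in>Pow (N - B). \<Prod>v\<in>S. q v)" by (simp add: sum_distrib_left)
  also have "(\<Sum>S\<in>Pow (N - B). \<Prod>v\<in>S. q v) = (\<Prod>v\<in>N - B. q v + 1)"
    using prod_add[OF fin(2), of q "\<lambda>_. 1"] by simp
  finally show ?thesis by (simp add: add.commute)
qed

section \<open>The bottleneck in the posterior\<close>

definition tree_weight :: "nat \<Rightarrow> real \<Rightarrow> (nat \<Rightarrow> real) \<Rightarrow> node set \<Rightarrow> real" where
  "tree_weight n p Y T = prior_weight (\<lambda>_. p) T * (\<Prod>v\<in>T. node_evidence n Y v)"

lemma node_evidence_pos: "0 < node_evidence n Y v"
  by (simp add: node_evidence_def)

lemma tree_weight_eq: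
  "tree_weight n p Y T = (\<Prod>v\<in>T. p * node_evidence n Y v) * (1 - p) ^ card (ext_nodes T)"
  by (simp add: tree_weight_def prior_weight_def prod.distrib)

lemma tree_weight_pos:
  assumes "0 < p" "p < 1"
  shows "0 < tree_weight n p Y T"
  unfolding tree_weight_eq using assms by (intro mult_pos_pos prod_pos) (auto simp: node_evidence_pos)

text \<open>The normal density of the data at mean zero and the normalizing constant of the prior
  are common to all trees and cancel.\<close>

lemma posterior_eq_tree_weight:
  fixes n m L :: nat
  assumes n: "n = 2 ^ (m + 1)" and L: "L \<le> m" and p: "0 < p" "p < 1" and T: "T \<in> trees L"
  shows "posterior n L (\<lambda>_. p) Y T = tree_weight n p Y T / (\<Sum>U\<in>trees L. tree_weight n p Y U)"
proof -
  define K where "K = (\<Prod>i\<in>{1..n}. std_normal_density (Y i)) / (\<Sum>U\<in>trees L. prior_weight (\<lambda>_. p) U)"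
  have prior_pos: "0 < prior_weight (\<lambda>_. p) U" for U
    unfolding prior_weight_def using p by (intro mult_pos_pos prod_pos) auto
  have "0 < (\<Sum>U\<in>trees L. prior_weight (\<lambda>_. p) U)"
    using prior_pos null_tree by (intro sum_pos) auto
  moreover have "0 < (\<Prod>i\<in>{1..n}. std_normal_density (Y i))"
    by (intro prod_pos) (simp add: normal_density_pos)
  ultimately have K: "K \<noteq> 0" unfolding K_def by (metis divide_pos_pos less_irrefl)
  have eq: "prior L (\<lambda>_. p) U * marginal_likelihood n U Y = K * tree_weight n p Y U"
    if U: "U \<in> trees L" for U
  proof -
    have "U \<subseteq> nodes m" using U nodes_mono[OF L] by (auto simp: trees_def)
    then show ?thesis
      by (simp add: marginal_likelihood_factorizes[OF n _ tree_finite[OF U]] prior_def K_def tree_weight_def)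
  qed
  have "(\<Sum>U\<in>trees L. prior L (\<lambda>_. p) U * marginal_likelihood n U Y)
      = K * (\<Sum>U\<in>trees L. tree_weight n p Y U)"
    unfolding sum_distrib_left by (intro sum.cong refl eq)
  then show ?thesis unfolding posterior_def eq[OF T] using K by simp
qed

lemma cart_chain:
  fixes n m L :: nat
  assumes n: "n = 2 ^ (m + 1)" and L: "L \<le> m" and p: "0 < p" "p < 1"
  shows "lazy_reversible_chain (trees L) (lazy_kernel n L (\<lambda>_. p) Y) (posterior n L (\<lambda>_. p) Y)"
proof (rule lazy_cart_chain)
  let ?Z = "\<Sum>U\<in>trees L. tree_weight n p Y U"
  have Z: "0 < ?Z"
    using null_tree by (intro sum_pos) (auto simp: tree_weight_pos p)
  show "0 < posterior n L (\<lambda>_. p) Y T" if "T \<in> trees L" for T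
    unfolding posterior_eq_tree_weight[OF n L p that] using Z by (simp add: tree_weight_pos p)
  have "(\<Sum>T\<in>trees L. posterior n L (\<lambda>_. p) Y T) = (\<Sum>T\<in>trees L. tree_weight n p Y T / ?Z)"
    by (intro sum.cong refl posterior_eq_tree_weight[OF n L p])
  then show "(\<Sum>T\<in>trees L. posterior n L (\<lambda>_. p) Y T) = 1"
    using Z by (simp flip: sum_divide_distrib)
qed

lemma tree_weight_le:
  assumes "0 < p" "p < 1"
  shows "tree_weight n p Y T \<le> (\<Prod>v\<in>T. p * node_evidence n Y v)"
proof -
  have "0 \<le> (\<Prod>v\<in>T. p * node_evidence n Y v)"
    using assms by (intro prod_nonneg) (simp add: node_evidence_pos less_imp_le)
  then show ?thesis unfolding tree_weight_eq
    using assms by (intro mult_right_le_one_le) (auto simp: power_le_one)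
qed

lemma tree_weight_ge:
  assumes "0 < p" "p \<le> 1/2" "card (ext_nodes T) \<le> k"
  shows "(\<Prod>v\<in>T. p * node_evidence n Y v) * (1/2) ^ k \<le> tree_weight n p Y T"
  unfolding tree_weight_eq
proof (intro mult_left_mono)
  have "(1/2::real) ^ k \<le> (1/2) ^ card (ext_nodes T)" using assms(3) by (intro power_decreasing) auto
  also have "\<dots> \<le> (1 - p) ^ card (ext_nodes T)" using assms by (intro power_mono) auto
  finally show "(1/2) ^ k \<le> (1 - p) ^ card (ext_nodes T)" .
  show "0 \<le> (\<Prod>v\<in>T. p * node_evidence n Y v)"
    using assms by (intro prod_nonneg) (simp add: node_evidence_pos less_imp_le)
qed

text \<open>Here \<open>A\<close> consists of the trees without the signal node, and only those of them that contain the
  whole path of noise nodes above it can leave \<open>A\<close> in one step. The path contributes \<open>w ^ (d + 1)\<close> to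
  their weights, and the remaining nodes contribute at most \<open>exp (1/2) \<le> 2\<close> after summation. The
  condition \<open>signal\<close> makes the single tree \<open>spine (d + 2)\<close> outweigh all of \<open>A\<close>; its power of 4 pays
  for the factors \<open>1 - p \<ge> 1/2\<close> of at most \<open>2 * (d + 3)\<close> external nodes. The constant 8 collects 2 from
  that summation, 2 from \<open>1 - p \<ge> 1/2\<close> in the weight of the null tree, and 2 from
  \<open>1 - \<pi>(A) \<ge> 1/2\<close>.\<close>

theorem spine_bottleneck:
  fixes n m d :: nat and p w :: real and Y :: "nat \<Rightarrow> real"
  defines "A \<equiv> {T \<in> trees (d + 2). Node (d + 1) 0 \<notin> T}"
    and "\<pi> \<equiv> posterior n (d + 2) (\<lambda>_. p) Y"
    and "q \<equiv> \<lambda>v. p * node_evidence n Y v"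
  assumes n: "n = 2 ^ (m + 1)" and d: "d + 2 \<le> m" and p: "0 < p" "p \<le> 1/2"
    and quiet: "\<And>v. v \<in> nodes (d + 2) \<Longrightarrow> v \<noteq> Root \<Longrightarrow> v \<noteq> Node (d + 1) 0 \<Longrightarrow> q v \<le> w"
    and w: "0 < w" "2 ^ (d + 2) * w \<le> 1/2"
    and signal: "2 * 4 ^ (d + 3) \<le> (\<Prod>l<d + 2. q (Node l 0))"
  shows "0 < sum \<pi> A" "sum \<pi> A < 1"
    and "lazy_reversible_chain.escape_flow (trees (d + 2)) (lazy_kernel n (d + 2) (\<lambda>_. p) Y) \<pi> A
      \<le> 8 * w ^ (d + 1) * (sum \<pi> A * (1 - sum \<pi> A))"
proof -
  let ?L = "d + 2" and ?S = "trees (d + 2)" and ?P = "lazy_kernel n (d + 2) (\<lambda>_. p) Y"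
  let ?W = "tree_weight n p Y"
  define Z where "Z = (\<Sum>U\<in>?S. ?W U)"
  define D where "D = {T \<in> A. Node d 0 \<in> T}"
  have p1: "p < 1" using p by simp
  interpret lazy_reversible_chain ?S ?P \<pi>
    unfolding \<pi>_def by (rule cart_chain[OF n d p(1) p1])
  have \<pi>: "\<pi> T = ?W T / Z" if "T \<in> ?S" for T
    unfolding \<pi>_def Z_def by (rule posterior_eq_tree_weight[OF n d p(1) p1 that])
  have W_pos: "0 < ?W T" for T by (rule tree_weight_pos[OF p(1) p1])
  have Z_pos: "0 < Z" unfolding Z_def using null_tree by (intro sum_pos) (auto simp: W_pos)
  have q_pos: "0 < q v" for v using p by (simp add: q_def node_evidence_pos)
  have A: "A \<subseteq> ?S" and D: "D \<subseteq> A" by (auto simp: A_def D_def)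
  have finA: "finite A" using A finite_S by (rule finite_subset)
  have \<pi>_sum_eq: "sum \<pi> B = sum ?W B / Z" if "B \<subseteq> ?S" for B
    unfolding sum_divide_distrib using that \<pi> by (intro sum.cong refl) auto

  have subset_sum: "(\<Sum>T\<in>F. ?W T) \<le> 2 * (\<Prod>v\<in>B. q v)"
    if F: "F \<subseteq> A" "\<And>T. T \<in> F \<Longrightarrow> B \<subseteq> T" and B: "Root \<in> B" "B \<subseteq> nodes ?L - {Node (d + 1) 0}" for F B
  proof -
    let ?N = "nodes ?L - {Node (d + 1) 0}"
    have "(\<Sum>T\<in>F. ?W T) \<le> (\<Sum>T\<in>F. \<Prod>v\<in>T. q v)"
      unfolding q_def by (intro sum_mono tree_weight_le p p1)
    also have "\<dots> \<le> (\<Prod>v\<in>B. q v) * (\<Prod>v\<in>?N - B. 1 + q v)"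
      using F B q_pos by (intro sum_prod_between) (auto simp: A_def trees_def less_imp_le)
    also have "\<dots> \<le> (\<Prod>v\<in>B. q v) * 2"
    proof (intro mult_left_mono)
      have "(\<Prod>v\<in>?N - B. 1 + q v) \<le> (\<Prod>v\<in>?N - B. exp w)"
      proof (intro prod_mono conjI)
        fix v assume "v \<in> ?N - B"
        then have "q v \<le> w" using B by (intro quiet) auto
        then show "1 + q v \<le> exp w" using exp_ge_add_one_self[of w] by linarith
        show "0 \<le> 1 + q v" using q_pos[of v] by simp
      qed
      also have "\<dots> = exp (real (card (?N - B)) * w)" by (simp add: exp_of_nat_mult)
      also have "\<dots> \<le> exp (1/2)"
      proof -
        have "card (?N - B) \<le> 2 ^ ?L"
          using card_mono[of "nodes ?L" "?N - B"] card_nodes[of ?L] by (meson Diff_subset finite_nodes order_trans)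
        then have "real (card (?N - B)) \<le> 2 ^ ?L" by (metis of_nat_le_iff of_nat_numeral of_nat_power)
        then have "real (card (?N - B)) * w \<le> 2 ^ ?L * w" using w by (intro mult_right_mono) auto
        then show ?thesis using w(2) by (simp only: exp_le_cancel_iff)
      qed
      also have "\<dots> \<le> (2::real)"
        using exp_bound_half[of "1/2 :: real"] by simp
      finally show "(\<Prod>v\<in>?N - B. 1 + q v) \<le> 2" .
      show "0 \<le> (\<Prod>v\<in>B. q v)" using q_pos by (intro prod_nonneg) (auto intro: less_imp_le)
    qed
    finally show ?thesis by (simp add: mult.commute)
  qed

  have sum_A: "(\<Sum>T\<in>A. ?W T) \<le> 2 * q Root"
    using subset_sum[of A "{Root}"] by (auto simp: A_def trees_def)
  have sum_D: "(\<Sum>T\<in>D. ?W T) \<le> 2 * (q Root * w ^ (d + 1))"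
  proof -
    have "(\<Sum>T\<in>D. ?W T) \<le> 2 * (\<Prod>v\<in>spine (d + 1). q v)"
    proof (rule subset_sum[OF D])
      show "spine (d + 1) \<subseteq> T" if "T \<in> D" for T
        using that spine_subset_tree[of T ?L d] by (auto simp: D_def A_def)
    qed (auto simp: spine_def)
    also have "(\<Prod>v\<in>spine (d + 1). q v) \<le> q Root * w ^ (d + 1)"
    proof -
      have "(\<Prod>l<d + 1. q (Node l 0)) \<le> (\<Prod>l<d + 1. w)"
        using q_pos by (intro prod_mono conjI quiet) (auto intro: less_imp_le)
      then show ?thesis unfolding prod_spine using q_pos[of Root] by (intro mult_left_mono) auto
    qed
    finally show ?thesis by simp
  qed
  have root: "q Root / 2 \<le> ?W {Root}"
  proof -
    have "ext_nodes {Root} = {Node 0 0}" by (simp add: ext_nodes_def)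
    then show ?thesis using tree_weight_ge[OF p, of "{Root}" 1 n Y] by (simp add: q_def)
  qed
  have root_A: "{Root} \<in> A" using null_tree by (auto simp: A_def)
  have full: "2 * q Root \<le> ?W (spine ?L)"
  proof -
    have "card (ext_nodes (spine ?L)) \<le> 2 * (d + 3)"
      using card_ext_nodes[of "spine ?L"] by (simp add: card_spine)
    then have "(\<Prod>v\<in>spine ?L. q v) * (1/2) ^ (2 * (d + 3)) \<le> ?W (spine ?L)"
      unfolding q_def by (rule tree_weight_ge[OF p])
    moreover have "q Root * (2 * 4 ^ (d + 3)) * (1/2) ^ (2 * (d + 3)) \<le> (\<Prod>v\<in>spine ?L. q v) * (1/2) ^ (2 * (d + 3))"
      unfolding prod_spine using q_pos[of Root] signal by (intro mult_right_mono mult_left_mono) auto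
    moreover have "(4::real) ^ (d + 3) * (1/2) ^ (2 * (d + 3)) = 1"
    proof -
      have "(1/2::real) ^ (2 * (d + 3)) = (1/4) ^ (d + 3)"
        unfolding power_mult by (simp add: power2_eq_square)
      then show ?thesis by (simp only: power_mult_distrib[symmetric]) simp
    qed
    then have "q Root * (2 * 4 ^ (d + 3)) * (1/2) ^ (2 * (d + 3)) = 2 * q Root"
      by (metis mult.assoc mult.commute mult.right_neutral)
    ultimately show ?thesis by linarith
  qed
  have spine: "spine ?L \<in> ?S - A" using spine_tree[of ?L] by (auto simp: A_def spine_def)

  have \<pi>A: "0 < sum \<pi> A"
    unfolding \<pi>_sum_eq[OF A] using root_A finA W_pos Z_pos by (intro divide_pos_pos sum_pos) auto
  have half: "sum \<pi> A \<le> 1/2"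
  proof -
    have "sum ?W A \<le> ?W (spine ?L)" using sum_A full by simp
    also have "\<dots> \<le> sum ?W (?S - A)" using spine W_pos by (intro member_le_sum) (auto intro: less_imp_le)
    finally have "2 * sum ?W A \<le> Z" unfolding Z_def using sum.subset_diff[OF A finite_S, of ?W] by simp
    then show ?thesis unfolding \<pi>_sum_eq[OF A] using Z_pos by (simp add: field_simps)
  qed
  show "0 < sum \<pi> A" "sum \<pi> A < 1" using \<pi>A half by auto

  have "escape_flow A \<le> (\<Sum>T\<in>A. if Node d 0 \<in> T then \<pi> T else 0)"
    unfolding escape_flow_def
  proof (intro sum_mono)
    fix T assume T: "T \<in> A"
    then have TS: "T \<in> ?S" using A by auto
    show "(\<Sum>U\<in>?S - A. \<pi> T * ?P T U) \<le> (if Node d 0 \<in> T then \<pi> T else 0)"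
    proof (cases "Node d 0 \<in> T")
      case True
      have "(\<Sum>U\<in>?S - A. ?P T U) \<le> (\<Sum>U\<in>?S. ?P T U)"
        using finite_S P_nonneg TS by (intro sum_mono2) auto
      then have "\<pi> T * (\<Sum>U\<in>?S - A. ?P T U) \<le> \<pi> T * 1"
        using P_sum[OF TS] \<pi>_nonneg[OF TS] by (intro mult_left_mono) auto
      then show ?thesis using True by (simp add: sum_distrib_left)
    next
      case False
      have "?P T U = 0" if U: "U \<in> ?S - A" for U
      proof -
        have "U \<noteq> T" using U T by auto
        moreover have "proposal ?L T U = 0"
          using proposal_enters_deep_node[of ?L T U d] False T U by (auto simp: A_def)
        ultimately show ?thesis by (simp add: lazy_kernel_def mh_kernel_def)
      qed
      then show ?thesis using False by simp
    qed
  qed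
  also have "\<dots> = sum \<pi> D"
    unfolding D_def using finA by (simp add: sum.If_cases Int_def)
  also have "\<dots> = sum ?W D / Z" using A D by (intro \<pi>_sum_eq) auto
  also have "\<dots> \<le> 4 * w ^ (d + 1) * (?W {Root} / Z)"
  proof -
    have "sum ?W D \<le> 4 * w ^ (d + 1) * (q Root / 2)" using sum_D by (simp add: mult_ac)
    also have "\<dots> \<le> 4 * w ^ (d + 1) * ?W {Root}" using root w by (intro mult_left_mono) auto
    finally have "sum ?W D / Z \<le> 4 * w ^ (d + 1) * ?W {Root} / Z" using Z_pos by (intro divide_right_mono) auto
    then show ?thesis by simp
  qed
  also have "\<dots> \<le> 4 * w ^ (d + 1) * sum \<pi> A"
  proof (intro mult_left_mono)
    have "?W {Root} / Z = \<pi> {Root}" using null_tree by (simp add: \<pi>)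
    also have "\<dots> \<le> sum \<pi> A" using root_A finA A \<pi>_nonneg by (intro member_le_sum) auto
    finally show "?W {Root} / Z \<le> sum \<pi> A" .
  qed (use w in simp)
  also have "\<dots> \<le> 4 * w ^ (d + 1) * (2 * (sum \<pi> A * (1 - sum \<pi> A)))"
  proof (intro mult_left_mono)
    have "sum \<pi> A * (1/2) \<le> sum \<pi> A * (1 - sum \<pi> A)" using half \<pi>A by (intro mult_left_mono) auto
    then show "sum \<pi> A \<le> 2 * (sum \<pi> A * (1 - sum \<pi> A))" by simp
  qed (use w in simp)
  finally show "escape_flow A \<le> 8 * w ^ (d + 1) * (sum \<pi> A * (1 - sum \<pi> A))" by simp
qed

section \<open>The noise is uniformly small\<close>

lemma gaussian_exp_moment:
  fixes \<mu> s :: real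
  defines "D \<equiv> density lborel (normal_density \<mu> 1)"
  shows "integrable D (\<lambda>y. exp (s * (y - \<mu>)))"
    and "(\<integral>y. exp (s * (y - \<mu>)) \<partial>D) = exp (s\<^sup>2 / 2)"
proof -
  have shift: "normal_density \<mu> 1 y *\<^sub>R exp (s * (y - \<mu>)) = exp (s\<^sup>2 / 2) * normal_density (\<mu> + s) 1 y" for y
  proof -
    have e: "- (y - \<mu>)\<^sup>2 / (2 * 1\<^sup>2) + s * (y - \<mu>) = s\<^sup>2 / 2 + - (y - (\<mu> + s))\<^sup>2 / (2 * 1\<^sup>2)"
    proof -
      have "- z\<^sup>2 / (2 * 1\<^sup>2) + s * z = s\<^sup>2 / 2 + - (z - s)\<^sup>2 / (2 * 1\<^sup>2)" for z
        by (simp add: power2_diff diff_divide_distrib add_divide_distrib mult.commute)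
      from this[of "y - \<mu>"] show ?thesis by (simp only: diff_diff_eq)
    qed
    have "normal_density \<mu> 1 y *\<^sub>R exp (s * (y - \<mu>))
        = 1 / sqrt (2 * pi * 1\<^sup>2) * exp (- (y - \<mu>)\<^sup>2 / (2 * 1\<^sup>2) + s * (y - \<mu>))"
      unfolding exp_add normal_density_def real_scaleR_def by (simp only: mult.assoc)
    also have "\<dots> = exp (s\<^sup>2 / 2) * normal_density (\<mu> + s) 1 y"
      unfolding e exp_add normal_density_def by (simp only: mult_ac)
    finally show ?thesis .
  qed
  show "integrable D (\<lambda>y. exp (s * (y - \<mu>)))"
    unfolding D_def by (subst integrable_density) (simp_all add: shift del: real_scaleR_def)
  show "(\<integral>y. exp (s * (y - \<mu>)) \<partial>D) = exp (s\<^sup>2 / 2)"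
    unfolding D_def by (subst integral_density) (simp_all add: shift del: real_scaleR_def)
qed

lemma prob_space_law_Y: "prob_space (law_Y n f0)"
  unfolding law_Y_def by (intro prob_space_PiM prob_space_normal_density) simp

lemma sets_law_Y [measurable_cong]: "sets (law_Y n f0) = sets (PiM {1..n} (\<lambda>_. borel))"
  unfolding law_Y_def by (intro sets_PiM_cong) simp_all

lemma measurable_observation [measurable]:
  "i \<in> {1..n} \<Longrightarrow> (\<lambda>Y. Y i) \<in> borel_measurable (law_Y n f0)"
  by (subst measurable_cong_sets[OF sets_law_Y refl]) (rule measurable_component_singleton)

lemma measurable_linear_statistic [measurable]:
  "(\<lambda>Y. \<Sum>i\<in>{1..n}. a i * (Y i - b i)) \<in> borel_measurable (law_Y n f0)" for a b :: "nat \<Rightarrow> real"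
  by (intro borel_measurable_sum borel_measurable_times borel_measurable_diff
      measurable_observation borel_measurable_const)

text \<open>Markov's inequality for the exponential moment, which factorizes over the independent
  observations. The parameter \<open>s\<close> is the optimal one for the threshold \<open>s * n\<close>.\<close>

lemma gaussian_linear_tail:
  fixes a :: "nat \<Rightarrow> real"
  assumes n: "0 < n" and a: "(\<Sum>i\<in>{1..n}. (a i)\<^sup>2) = real n" and s: "0 < s"
  shows "measure (law_Y n f0)
      {Y \<in> space (law_Y n f0). s * real n \<le> (\<Sum>i\<in>{1..n}. a i * (Y i - f0 (real i / real n)))}
    \<le> exp (- (s\<^sup>2 * real n / 2))"
proof -
  let ?M = "\<lambda>i. density lborel (normal_density (f0 (real i / real n)) 1)"
  let ?e = "\<lambda>Y. \<Sum>i\<in>{1..n}. a i * (Y i - f0 (real i / real n))"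
  interpret P: prob_space "law_Y n f0" by (rule prob_space_law_Y)
  have "prob_space (?M i)" for i by (rule prob_space_normal_density) simp
  then interpret prod: product_sigma_finite ?M
    by (intro product_sigma_finite.intro prob_space_imp_sigma_finite) 
  have factor: "exp (s * ?e Y) = (\<Prod>i\<in>{1..n}. exp (s * a i * (Y i - f0 (real i / real n))))" for Y
    by (simp only: exp_sum finite_atLeastAtMost sum_distrib_left mult.assoc)
  have int: "integrable (law_Y n f0) (\<lambda>Y. exp (s * ?e Y))"
    unfolding factor law_Y_def
    by (intro prod.product_integrable_prod gaussian_exp_moment) simp
  have "(\<integral>Y. exp (s * ?e Y) \<partial>law_Y n f0) = (\<Prod>i\<in>{1..n}. exp ((s * a i)\<^sup>2 / 2))"
    unfolding factor law_Y_def
    by (simp only: prod.product_integral_prod[OF finite_atLeastAtMost gaussian_exp_moment(1)]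
        gaussian_exp_moment(2))
  also have "\<dots> = exp (\<Sum>i\<in>{1..n}. s\<^sup>2 * (a i)\<^sup>2 / 2)"
    by (simp add: exp_sum power_mult_distrib)
  also have "(\<Sum>i\<in>{1..n}. s\<^sup>2 * (a i)\<^sup>2 / 2) = s\<^sup>2 * real n / 2"
    unfolding a[symmetric] by (simp add: sum_distrib_left sum_divide_distrib)
  finally have moment: "(\<integral>Y. exp (s * ?e Y) \<partial>law_Y n f0) = exp (s\<^sup>2 * real n / 2)" .
  have "{Y \<in> space (law_Y n f0). s * real n \<le> ?e Y}
      = {Y \<in> space (law_Y n f0). exp (s * (s * real n)) \<le> exp (s * ?e Y)}"
    using s by simp
  then have "measure (law_Y n f0) {Y \<in> space (law_Y n f0). s * real n \<le> ?e Y}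
      \<le> (\<integral>Y. exp (s * ?e Y) \<partial>law_Y n f0) / exp (s * (s * real n))"
    using integral_Markov_inequality_measure[OF int sets.empty_sets, of "exp (s * (s * real n))"] by simp
  also have "\<dots> = exp (- (s\<^sup>2 * real n / 2))"
    unfolding moment exp_diff[symmetric] by (simp add: power2_eq_square)
  finally show ?thesis .
qed

text \<open>The threshold is twice the square root of log n in units of the standard deviation \<open>sqrt n\<close>.\<close>

definition quiet_noise :: "nat \<Rightarrow> nat \<Rightarrow> (real \<Rightarrow> real) \<Rightarrow> (nat \<Rightarrow> real) set" where
  "quiet_noise n L f0 = {Y \<in> space (law_Y n f0).
     \<forall>v\<in>nodes L. \<bar>\<Sum>i\<in>{1..n}. haar v (real i / real n) * (Y i - f0 (real i / real n))\<bar>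
       \<le> 2 * sqrt (real n * ln (real n))}"

text \<open>Each of the at most \<open>n/2\<close> nodes exceeds the threshold, on either side, with probability at
  most \<open>2/n\<^sup>2\<close>.\<close>

lemma quiet_noise_likely:
  fixes n m L :: nat
  assumes n: "n = 2 ^ (m + 1)" and L: "L \<le> m"
  shows "quiet_noise n L f0 \<in> sets (law_Y n f0)"
    and "1 - 1 / real n \<le> measure (law_Y n f0) (quiet_noise n L f0)"
proof -
  note fin = finite_nodes[of L] and card = card_nodes[of L] and sub = nodes_mono[OF L]
  interpret P: prob_space "law_Y n f0" by (rule prob_space_law_Y)
  let ?\<Omega> = "space (law_Y n f0)"
  let ?e = "\<lambda>v Y. \<Sum>i\<in>{1..n}. haar v (real i / real n) * (Y i - f0 (real i / real n))"
  have n2: "2 \<le> n" by (simp add: n)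
  define s where "s = 2 * sqrt (ln (real n) / real n)"
  have s0: "0 < s" using n2 by (simp add: s_def)
  have sn: "s * real n = 2 * sqrt (real n * ln (real n))"
    using n2 by (simp add: s_def real_sqrt_divide real_sqrt_mult real_div_sqrt field_simps)
  have s2: "s\<^sup>2 * real n / 2 = 2 * ln (real n)"
    using n2 by (simp add: s_def power_mult_distrib)
  let ?up = "\<lambda>v. {Y \<in> ?\<Omega>. s * real n \<le> ?e v Y}"
  let ?down = "\<lambda>v. {Y \<in> ?\<Omega>. s * real n \<le> (\<Sum>i\<in>{1..n}. - haar v (real i / real n) * (Y i - f0 (real i / real n)))}"
  have sets: "?up v \<in> sets (law_Y n f0)" "?down v \<in> sets (law_Y n f0)" for v by measurable
  show meas: "quiet_noise n L f0 \<in> sets (law_Y n f0)"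
    unfolding quiet_noise_def by (intro sets.sets_Collect_finite_All fin) measurable
  have tail: "P.prob (?up v \<union> ?down v) \<le> 2 / (real n)\<^sup>2" if v: "v \<in> nodes L" for v
  proof -
    have sq: "(\<Sum>i\<in>{1..n}. (haar v (real i / real n))\<^sup>2) = real n"
      using haar_orthogonal[OF n, of v v] v sub by (auto simp: power2_eq_square)
    then have sq': "(\<Sum>i\<in>{1..n}. (- haar v (real i / real n))\<^sup>2) = real n" by simp
    have "exp (- (s\<^sup>2 * real n / 2)) = 1 / (real n)\<^sup>2"
      unfolding s2 using n2 by (simp add: exp_minus exp_double field_simps)
    then have "P.prob (?up v) \<le> 1 / (real n)\<^sup>2" "P.prob (?down v) \<le> 1 / (real n)\<^sup>2"
      using gaussian_linear_tail[OF _ sq s0] gaussian_linear_tail[OF _ sq' s0] n2 by auto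
    then show ?thesis
      using measure_Un_le[OF sets, of v v] by (simp add: add_divide_distrib[symmetric])
  qed
  have "?\<Omega> - quiet_noise n L f0 \<subseteq> (\<Union>v\<in>nodes L. ?up v \<union> ?down v)"
  proof
    fix Y assume Y: "Y \<in> ?\<Omega> - quiet_noise n L f0"
    then obtain v where v: "v \<in> nodes L" "\<not> \<bar>?e v Y\<bar> \<le> 2 * sqrt (real n * ln (real n))"
      by (auto simp: quiet_noise_def)
    have "(\<Sum>i\<in>{1..n}. - haar v (real i / real n) * (Y i - f0 (real i / real n))) = - ?e v Y"
      by (simp add: sum_negf)
    moreover have "s * real n \<le> ?e v Y \<or> s * real n \<le> - ?e v Y"
      using v(2) unfolding sn by linarith
    ultimately have "v \<in> nodes L \<and> Y \<in> ?up v \<union> ?down v"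
      using v(1) Y by (simp only: mem_Collect_eq Un_iff Diff_iff simp_thms)
    then show "Y \<in> (\<Union>v\<in>nodes L. ?up v \<union> ?down v)"
      by (intro UN_I[of v]) (erule conjunct1, erule conjunct2)
  qed
  then have "P.prob (?\<Omega> - quiet_noise n L f0) \<le> P.prob (\<Union>v\<in>nodes L. ?up v \<union> ?down v)"
    using sets fin by (intro P.finite_measure_mono sets.finite_UN) auto
  also have "\<dots> \<le> (\<Sum>v\<in>nodes L. P.prob (?up v \<union> ?down v))"
    using sets fin by (intro measure_UNION_le) auto
  also have "\<dots> \<le> (\<Sum>v\<in>nodes L. 2 / (real n)\<^sup>2)" by (intro sum_mono tail)
  also have "\<dots> = real (card (nodes L)) * (2 / (real n)\<^sup>2)" by simp
  also have "\<dots> \<le> (real n / 2) * (2 / (real n)\<^sup>2)"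
  proof (intro mult_right_mono)
    have "card (nodes L) \<le> 2 ^ m" using card L by (meson one_le_numeral order_trans power_increasing)
    then have "real (card (nodes L)) \<le> real (2 ^ m)" by (simp only: of_nat_le_iff)
    then show "real (card (nodes L)) \<le> real n / 2" by (simp add: n)
  qed simp
  also have "\<dots> = 1 / real n" using n2 by (simp add: power2_eq_square)
  finally show "1 - 1 / real n \<le> P.prob (quiet_noise n L f0)"
    using P.prob_compl[OF meas] by simp
qed

section \<open>Measurability of the mixing time\<close>

lemma measurable_mixing_time:
  fixes P :: "'y \<Rightarrow> 'a \<Rightarrow> 'a \<Rightarrow> real" and \<mu> :: "'y \<Rightarrow> 'a \<Rightarrow> real"
  assumes S: "finite S" "S \<noteq> {}"
    and P[measurable]: "\<And>x y. x \<in> S \<Longrightarrow> y \<in> S \<Longrightarrow> (\<lambda>Y. P Y x y) \<in> borel_measurable M"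
    and \<mu>[measurable]: "\<And>x. x \<in> S \<Longrightarrow> (\<lambda>Y. \<mu> Y x) \<in> borel_measurable M"
  shows "{Y \<in> space M. ereal r < ereal_of_enat (mixing_time S (P Y) (\<mu> Y) \<epsilon>)} \<in> sets M"
proof -
  have pow: "(\<lambda>Y. kernel_pow S (P Y) t x y) \<in> borel_measurable M" if "x \<in> S" "y \<in> S" for t x y
    using that
  proof (induction t arbitrary: x)
    case (Suc t)
    then show ?case
      by (simp only: kernel_pow.simps) (intro borel_measurable_sum borel_measurable_times P; simp)
  qed simp
  have tv: "{Y \<in> space M. tv_dist S (kernel_pow S (P Y) t x) (\<mu> Y) \<le> \<epsilon>} \<in> sets M" if x: "x \<in> S" for t x
  proof -
    have "tv_dist S \<nu> \<mu>' \<le> \<epsilon> \<longleftrightarrow> (\<forall>A\<in>Pow S. \<bar>(\<Sum>x\<in>A. \<nu> x) - (\<Sum>x\<in>A. \<mu>' x)\<bar> \<le> \<epsilon>)" for \<nu> \<mu>'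
      using S unfolding tv_dist_def by (subst Max_le_iff) auto
    moreover have "{Y \<in> space M. \<forall>A\<in>Pow S. \<bar>(\<Sum>y\<in>A. kernel_pow S (P Y) t x y) - (\<Sum>y\<in>A. \<mu> Y y)\<bar> \<le> \<epsilon>} \<in> sets M"
    proof (intro sets.sets_Collect_finite_All)
      fix A assume "A \<in> Pow S"
      then have "(\<lambda>Y. \<bar>(\<Sum>y\<in>A. kernel_pow S (P Y) t x y) - (\<Sum>y\<in>A. \<mu> Y y)\<bar>) \<in> borel_measurable M"
        using x by (intro borel_measurable_abs borel_measurable_diff borel_measurable_sum pow \<mu>) auto
      then show "{Y \<in> space M. \<bar>(\<Sum>y\<in>A. kernel_pow S (P Y) t x y) - (\<Sum>y\<in>A. \<mu> Y y)\<bar> \<le> \<epsilon>} \<in> sets M"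
        by measurable
    qed (use S in simp)
    ultimately show ?thesis by simp
  qed
  have "{Y \<in> space M. \<exists>x\<in>S. \<forall>t. 1 \<le> t \<and> (\<forall>t'. t \<le> t' \<longrightarrow> tv_dist S (kernel_pow S (P Y) t' x) (\<mu> Y) \<le> \<epsilon>)
      \<longrightarrow> r < real t} \<in> sets M"
    by (intro sets.sets_Collect_finite_Ex sets.sets_Collect_countable_All sets.sets_Collect_imp
        sets.sets_Collect_conj sets.sets_Collect_const tv S)
  then show ?thesis by (simp only: mixing_time_greater_iff[OF S])
qed

section \<open>Evidence of noise nodes and of the signal node\<close>

lemma score_eq_noise_plus_signal:
  fixes n m :: nat
  assumes n: "n = 2 ^ (m + 1)" and v: "v \<in> nodes m" and u: "u \<in> nodes m"
  shows "score n v Y = (\<Sum>i\<in>{1..n}. haar v (real i / real n) * (Y i - b * haar u (real i / real n)))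
    + (if v = u then b * real n else 0)"
proof -
  have "(\<Sum>i\<in>{1..n}. haar v (real i / real n) * (Y i - b * haar u (real i / real n)))
      = score n v Y - b * (\<Sum>i\<in>{1..n}. haar v (real i / real n) * haar u (real i / real n))"
    unfolding score_def sum_distrib_left sum_subtractf[symmetric]
    by (intro sum.cong refl) (simp add: algebra_simps)
  then show ?thesis unfolding haar_orthogonal[OF n v u] by simp
qed

text \<open>The exponent \<open>c - 3/2\<close> is \<open>c\<close> from the prior, plus 1/2 from the Occam factor (1+n)^(-1/2), minus 2
  from the largest noise, \<open>exp (4 * ln n / 2) = n\<^sup>2\<close>.\<close>

lemma noise_evidence_le:
  assumes n: "2 \<le> n" and score: "\<bar>score n v Y\<bar> \<le> 2 * sqrt (real n * ln (real n))"
  shows "real n powr (- c) * node_evidence n Y v \<le> real n powr (- (c - 3/2))"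
proof -
  have n0: "0 < real n" "0 \<le> ln (real n)" using n by auto
  have "(score n v Y)\<^sup>2 \<le> (2 * sqrt (real n * ln (real n)))\<^sup>2"
    using score by (metis abs_ge_zero power2_abs power_mono)
  also have "\<dots> = 4 * (real n * ln (real n))" using n0 by (simp add: power_mult_distrib)
  also have "\<dots> \<le> 4 * ((1 + real n) * ln (real n))" using n0 by (intro mult_left_mono mult_right_mono) auto
  finally have "(score n v Y)\<^sup>2 / (2 * (1 + real n)) \<le> 2 * ln (real n)"
    using n0 by (subst pos_divide_le_eq) (simp_all add: algebra_simps)
  then have "exp ((score n v Y)\<^sup>2 / (2 * (1 + real n))) \<le> real n powr 2"
    using n0 by (simp add: powr_def mult.commute)
  moreover have "1 / sqrt (1 + real n) \<le> real n powr (- (1/2))"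
    using n0 by (simp add: powr_minus_divide powr_half_sqrt frac_le)
  ultimately have "exp ((score n v Y)\<^sup>2 / (2 * (1 + real n))) * (1 / sqrt (1 + real n))
      \<le> real n powr 2 * real n powr (- (1/2))"
    by (intro mult_mono) auto
  then have "real n powr (- c) * node_evidence n Y v \<le> real n powr (- c) * (real n powr 2 * real n powr (- (1/2)))"
    by (intro mult_left_mono) (auto simp: node_evidence_def)
  also have "\<dots> = real n powr (- (c - 3/2))"
    unfolding powr_add[symmetric] by (rule arg_cong[where f = "\<lambda>x. real n powr x"]) simp
  finally show ?thesis .
qed

lemma evidence_ge:
  assumes "2 \<le> n"
  shows "real n powr (- (c + 1)) * exp ((score n v Y)\<^sup>2 / (2 * (1 + real n)))
    \<le> real n powr (- c) * node_evidence n Y v"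
proof -
  have "real (n + 1) \<le> real (n * n)"
  proof (intro of_nat_mono)
    have "2 * n \<le> n * n" using assms by (rule mult_le_mono1)
    then show "n + 1 \<le> n * n" using assms by linarith
  qed
  then have "sqrt (1 + real n) \<le> sqrt (real n * real n)" by (intro real_sqrt_le_mono) (simp add: add.commute)
  then have "1 / real n \<le> 1 / sqrt (1 + real n)" using assms by (intro divide_left_mono) auto
  then have "exp ((score n v Y)\<^sup>2 / (2 * (1 + real n))) * (1 / real n) \<le> node_evidence n Y v"
    unfolding node_evidence_def using mult_left_mono[OF _ exp_ge_zero] by fastforce
  then have "real n powr (- c) * (exp ((score n v Y)\<^sup>2 / (2 * (1 + real n))) * (1 / real n))
      \<le> real n powr (- c) * node_evidence n Y v"
    by (intro mult_left_mono) auto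
  moreover have "real n powr (- (c + 1)) = real n powr (- c) * (1 / real n)"
    using assms powr_add[of "real n" "- c" "- 1"] by (simp add: powr_minus_divide)
  ultimately show ?thesis by (simp add: mult_ac)
qed

lemma ln_le_2_sqrt: "0 < x \<Longrightarrow> ln x \<le> 2 * sqrt x" for x :: real
proof -
  assume x: "0 < x"
  have "ln (sqrt x) \<le> sqrt x - 1" using x by (intro ln_le_minus_one) simp
  then show ?thesis using x by (simp add: ln_sqrt)
qed

text \<open>The evidence of the signal grows like the exponential of a multiple of \<open>b\<^sup>2 * n\<close>, whereas a path of
  length \<open>L \<le> 2 * ln n\<close> costs only the exponential of a multiple of \<open>(ln n)\<^sup>2 \<le> 4 * n\<close>. So a
  coefficient \<open>b\<close> that does not depend on \<open>n\<close> suffices for all sample sizes.\<close>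

lemma signal_evidence_ge:
  fixes b c :: real and n L :: nat
  assumes n: "2 \<le> n" and L: "2 ^ L \<le> n" and c: "0 < c" and b: "4 \<le> b" "128 * (c + 3) \<le> b\<^sup>2"
    and score: "\<bar>score n v Y - b * real n\<bar> \<le> 2 * sqrt (real n * ln (real n))"
  shows "real n powr ((c + 3) * real L) \<le> exp ((score n v Y)\<^sup>2 / (2 * (1 + real n)))"
proof -
  let ?g = "score n v Y" and ?l = "ln (real n)"
  have n0: "0 < real n" "0 \<le> ?l" using n by auto
  have "real n * ?l \<le> real n * real n" using n0 ln_bound[of "real n"] by (intro mult_left_mono) auto
  then have "sqrt (real n * ?l) \<le> real n" using n0 real_le_lsqrt[of "real n" "real n * ?l"] by (simp add: power2_eq_square)
  moreover have "4 * real n \<le> b * real n" using b n0 by (intro mult_right_mono) auto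
  ultimately have "b * real n / 2 \<le> ?g" using score by linarith
  then have "(b * real n / 2)\<^sup>2 \<le> ?g\<^sup>2" using b by (intro power_mono) auto
  then have "b\<^sup>2 * real n / 16 * (4 * real n) \<le> ?g\<^sup>2" by (simp add: power2_eq_square mult_ac)
  moreover have "b\<^sup>2 * real n / 16 * (2 * (1 + real n)) \<le> b\<^sup>2 * real n / 16 * (4 * real n)"
    using n by (intro mult_left_mono) auto
  ultimately have "b\<^sup>2 * real n / 16 * (2 * (1 + real n)) \<le> ?g\<^sup>2" by (rule order_trans[rotated])
  then have g: "b\<^sup>2 * real n / 16 \<le> ?g\<^sup>2 / (2 * (1 + real n))"
    by (subst pos_le_divide_eq) auto
  have L2: "real L \<le> 2 * ?l"
  proof -
    have "(2::real) ^ L \<le> real n" using L by (metis of_nat_le_iff of_nat_numeral of_nat_power)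
    then have "ln ((2::real) ^ L) \<le> ?l" using n0 by (subst ln_le_cancel_iff) auto
    then have "real L * ln 2 \<le> ?l" by (simp add: ln_realpow)
    moreover have "real L * (1/2) \<le> real L * ln 2"
    proof (intro mult_left_mono)
      have "exp (1/2 :: real) \<le> 2" using exp_bound_half[of "1/2 :: real"] by simp
      then show "1/2 \<le> ln (2::real)" by (subst ln_ge_iff) auto
    qed simp
    ultimately show ?thesis by linarith
  qed
  have "?l * ?l \<le> (2 * sqrt (real n)) * (2 * sqrt (real n))"
    using n0 ln_le_2_sqrt[of "real n"] by (intro mult_mono) auto
  then have l2: "?l * ?l \<le> 4 * real n" using n0 by simp
  have "(c + 3) * real L * ?l \<le> (c + 3) * (2 * ?l) * ?l"
    using c n0 L2 by (intro mult_left_mono mult_right_mono) auto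
  also have "\<dots> = (c + 3) * 2 * (?l * ?l)" by simp
  also have "\<dots> \<le> (c + 3) * 2 * (4 * real n)" using c l2 by (intro mult_left_mono) auto
  also have "\<dots> = 128 * (c + 3) * real n / 16" by simp
  also have "\<dots> \<le> b\<^sup>2 * real n / 16" using b n0 by (intro divide_right_mono mult_right_mono) auto
  also note g
  finally show ?thesis using n0 by (simp add: powr_def)
qed

section \<open>Slow mixing\<close>

text \<open>The bottleneck has ratio \<open>8 * w ^ (d + 1)\<close>, where \<open>w = 1/N\<close> and \<open>N = n powr (c - 3/2)\<close>.
  Since \<open>N > 8\<close>, the reciprocal of this ratio exceeds \<open>N ^ d\<close>, which dominates the claimed power. For \<open>\<epsilon> \<ge> 1/2\<close>
  the claimed bound is below 1, hence below every positive time.\<close>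

lemma slow_mixing_on_quiet_noise:
  fixes c \<epsilon> :: real and n m d :: nat
  defines "b \<equiv> 128 * (c + 3)"
  assumes c: "5/2 < c" and n: "n = 2 ^ (m + 1)" and d: "d + 2 \<le> m" and \<epsilon>: "0 < \<epsilon>" "\<epsilon> < 1"
    and Y: "Y \<in> quiet_noise n (d + 2) (\<lambda>x. b * haar (Node (d + 1) 0) x)"
  shows "ereal (ln (1 / (2 * \<epsilon>)) * (1/4) * (((real n powr (c - 3/2) / 4 - 1) / 2) ^ d - 3))
    < ereal_of_enat (cart_mixing_time n (d + 2) (\<lambda>_. real n powr (- c)) Y \<epsilon>)"
proof -
  let ?L = "d + 2" and ?u = "Node (d + 1) 0"
  define p where "p = real n powr (- c)"
  define N where "N = real n powr (c - 3/2)"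
  define w where "w = real n powr (- (c - 3/2))"
  let ?P = "lazy_kernel n ?L (\<lambda>_. p) Y" and ?\<pi> = "posterior n ?L (\<lambda>_. p) Y"
  have "(2::nat) ^ 3 \<le> 2 ^ (m + 1)" using d by (intro power_increasing) auto
  then have n8: "8 \<le> n" by (simp add: n)
  have Ln: "2 * 2 ^ ?L \<le> n"
  proof -
    have "(2::nat) ^ (?L + 1) \<le> 2 ^ (m + 1)" using d by (intro power_increasing) auto
    then show ?thesis by (simp add: n)
  qed
  have n_less_N: "real n < N"
  proof -
    have "real n powr 1 < N" unfolding N_def using n8 c by (intro powr_less_mono) auto
    then show ?thesis using n8 by simp
  qed
  have wN: "w = 1 / N" unfolding w_def N_def by (rule powr_minus_divide)
  have p: "0 < p" "p \<le> 1/2"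
  proof -
    show "0 < p" using n8 by (simp add: p_def)
    have "real n powr (- c) \<le> real n powr (-1)" using n8 c by (intro powr_mono) auto
    also have "\<dots> \<le> 1/2" using n8 by (simp add: powr_minus_divide)
    finally show "p \<le> 1/2" by (simp add: p_def)
  qed
  have nodes: "nodes ?L \<subseteq> nodes m" using d by (rule nodes_mono)
  have u: "?u \<in> nodes ?L" by simp
  have score: "\<bar>score n v Y - (if v = ?u then b * real n else 0)\<bar> \<le> 2 * sqrt (real n * ln (real n))"
    if v: "v \<in> nodes ?L" for v
  proof -
    have "v \<in> nodes m" "?u \<in> nodes m" using v u nodes by blast+
    from score_eq_noise_plus_signal[OF n this, of Y b] show ?thesis
      using Y v by (simp add: quiet_noise_def)
  qed
  have quiet: "p * node_evidence n Y v \<le> w" if "v \<in> nodes ?L" "v \<noteq> Root" "v \<noteq> ?u" for v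
    unfolding p_def w_def using score[OF that(1)] that n8 by (intro noise_evidence_le) auto
  have signal: "2 * 4 ^ (d + 3) \<le> (\<Prod>l<?L. p * node_evidence n Y (Node l 0))"
  proof -
    have b: "4 \<le> b" "128 * (c + 3) \<le> b\<^sup>2"
    proof -
      show "4 \<le> b" using c by (simp add: b_def)
      then have "b * 1 \<le> b * b" by (intro mult_left_mono) auto
      then show "128 * (c + 3) \<le> b\<^sup>2" by (simp add: power2_eq_square b_def)
    qed
    \<comment> \<open>On the noise nodes of the spine the trivial bound, with the exponential replaced by 1, is enough.\<close>
    have low: "real n powr (- (c + 1)) \<le> p * node_evidence n Y v" for v
    proof -
      have "real n powr (- (c + 1)) * 1 \<le> real n powr (- (c + 1)) * exp ((score n v Y)\<^sup>2 / (2 * (1 + real n)))"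
        by (intro mult_left_mono) auto
      then show ?thesis using evidence_ge[of n c v Y] n8 unfolding p_def by linarith
    qed
    have "real n powr ((c + 3) * real ?L) \<le> exp ((score n ?u Y)\<^sup>2 / (2 * (1 + real n)))"
      using score[OF u] n8 Ln c b by (intro signal_evidence_ge[where b = b]) auto
    then have "real n powr (- (c + 1)) * real n powr ((c + 3) * real ?L)
        \<le> real n powr (- (c + 1)) * exp ((score n ?u Y)\<^sup>2 / (2 * (1 + real n)))"
      by (intro mult_left_mono) auto
    also have "\<dots> \<le> p * node_evidence n Y ?u" unfolding p_def using n8 by (intro evidence_ge) auto
    finally have top: "real n powr (- (c + 1)) * real n powr ((c + 3) * real ?L) \<le> p * node_evidence n Y ?u" .
    have "2 * 4 ^ (d + 3) \<le> real n ^ (2 * ?L)"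
    proof -
      have "(2::real) * 4 ^ (d + 3) \<le> 4 ^ (2 * ?L)"
      proof -
        have "(2::real) * 4 ^ (d + 3) \<le> 4 ^ (d + 4)" by (simp add: power_add)
        also have "\<dots> \<le> 4 ^ (2 * ?L)" by (intro power_increasing) auto
        finally show ?thesis .
      qed
      also have "\<dots> \<le> real n ^ (2 * ?L)" using n8 by (intro power_mono) auto
      finally show ?thesis .
    qed
    also have "real n ^ (2 * ?L) = (real n powr (- (c + 1))) ^ (d + 1)
        * (real n powr (- (c + 1)) * real n powr ((c + 3) * real ?L))"
    proof -
      have "(real n powr (- (c + 1))) ^ (d + 1) = real n powr (real (d + 1) * - (c + 1))"
        using n8 by (intro powr_power) simp
      moreover have "real n powr real (2 * ?L) = real n ^ (2 * ?L)" using n8 by (intro powr_realpow) auto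
      moreover have "real (2 * ?L) = real (d + 1) * - (c + 1) + (- (c + 1) + (c + 3) * real ?L)"
        by (simp add: algebra_simps)
      ultimately show ?thesis by (simp only: powr_add)
    qed
    also have "\<dots> \<le> (\<Prod>l<d + 1. p * node_evidence n Y (Node l 0)) * (p * node_evidence n Y ?u)"
    proof (rule mult_mono[OF _ top])
      have "(\<Prod>l<d + 1. real n powr (- (c + 1))) \<le> (\<Prod>l<d + 1. p * node_evidence n Y (Node l 0))"
        using low by (intro prod_mono) auto
      then show "(real n powr (- (c + 1))) ^ (d + 1) \<le> (\<Prod>l<d + 1. p * node_evidence n Y (Node l 0))"
        by simp
      show "0 \<le> (\<Prod>l<d + 1. p * node_evidence n Y (Node l 0))"
        using p by (intro prod_nonneg) (simp add: node_evidence_pos less_imp_le)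
    qed simp
    also have "\<dots> = (\<Prod>l<?L. p * node_evidence n Y (Node l 0))" by simp
    finally show ?thesis .
  qed
  have w: "0 < w" "2 ^ ?L * w \<le> 1/2"
  proof -
    show "0 < w" using n8 by (simp add: w_def)
    have "real (2 * 2 ^ ?L) \<le> real n" using Ln by (simp only: of_nat_le_iff)
    then have "2 * 2 ^ ?L \<le> N" using n_less_N by simp
    then show "2 ^ ?L * w \<le> 1/2" using n8 n_less_N by (simp add: wN field_simps)
  qed
  interpret lazy_reversible_chain "trees ?L" ?P ?\<pi>
    using p by (intro cart_chain[OF n d]) auto
  let ?A = "{T \<in> trees ?L. ?u \<notin> T}"
  let ?\<delta> = "8 * w ^ (d + 1)"
  note bottleneck = spine_bottleneck[OF n d p quiet w signal]
  have N8: "8 < N" using n8 n_less_N by simp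
  have \<delta>: "0 < ?\<delta>" "?\<delta> < 1"
  proof -
    show "0 < ?\<delta>" using w by simp
    have "w ^ (d + 1) \<le> w ^ 1" using w N8 by (intro power_decreasing) (auto simp: wN)
    moreover have "w < 1/8" using N8 by (simp add: wN field_simps)
    ultimately show "?\<delta> < 1" by simp
  qed
  have speed: "ln (1 / (2 * \<epsilon>)) * (1 / ?\<delta> - 1) \<le> real t"
    if "\<And>T. T \<in> trees ?L \<Longrightarrow> tv_dist (trees ?L) (kernel_pow (trees ?L) ?P t T) ?\<pi> \<le> \<epsilon>" for t
    by (rule mixing_time_lower_bound[OF _ bottleneck(1,2) \<delta> bottleneck(3) that \<epsilon>(1)]) auto
  define X where "X = (N / 4 - 1) / 2"
  have X: "0 \<le> X ^ d" "X ^ d \<le> N ^ d"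
    using N8 by (auto simp: X_def intro!: power_mono)
  have "ln (1 / (2 * \<epsilon>)) * (1/4) * (X ^ d - 3) < real t"
    if t: "1 \<le> t" and tv: "\<And>T. T \<in> trees ?L \<Longrightarrow> tv_dist (trees ?L) (kernel_pow (trees ?L) ?P t T) ?\<pi> \<le> \<epsilon>" for t
  proof (cases "\<epsilon> < 1/2")
    case True
    then have log_pos: "0 < ln (1 / (2 * \<epsilon>))" using \<epsilon> by simp
    have inverse_\<delta>: "1 / ?\<delta> = N ^ (d + 1) / 8" by (simp add: wN power_one_over field_simps)
    have compare: "1/4 * (x - 3) < M / 8 - 1" if "8 * y < M" "1 \<le> y" "x \<le> y" for x y M :: real
      using that by simp
    have "8 * N ^ d < N ^ (d + 1)" using N8 by simp
    moreover have "1 \<le> N ^ d" using N8 by (intro one_le_power) simp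
    ultimately have "1/4 * (X ^ d - 3) < 1 / ?\<delta> - 1"
      unfolding inverse_\<delta> using X(2) by (rule compare)
    then have "ln (1 / (2 * \<epsilon>)) * (1/4 * (X ^ d - 3)) < ln (1 / (2 * \<epsilon>)) * (1 / ?\<delta> - 1)"
      using log_pos by (rule mult_strict_left_mono)
    also have "\<dots> \<le> real t" by (rule speed[OF tv])
    finally show ?thesis by (simp only: mult.assoc)
  next
    case False
    have "ln (1 / (2 * \<epsilon>)) * (1/4) * (X ^ d - 3) = ln (2 * \<epsilon>) * (1/4) * (3 - X ^ d)"
    proof -
      have "ln (1 / (2 * \<epsilon>)) = - ln (2 * \<epsilon>)" using ln_inverse[of "2 * \<epsilon>"] \<epsilon> by (simp add: inverse_eq_divide)
      then show ?thesis by (simp only:) (simp add: right_diff_distrib diff_divide_distrib)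
    qed
    also have "\<dots> \<le> ln (2 * \<epsilon>) * (1/4) * 3"
      using X False by (intro mult_left_mono) auto
    also have "\<dots> < 1"
    proof -
      have "ln (2 * \<epsilon>) \<le> 2 * \<epsilon> - 1" using \<epsilon> by (intro ln_le_minus_one) simp
      then show ?thesis using \<epsilon> by simp
    qed
    finally show ?thesis using t by linarith
  qed
  then show ?thesis
    unfolding cart_mixing_time_def N_def[symmetric] X_def[symmetric] p_def[symmetric]
    using null_tree by (intro mixing_time_greaterI) auto
qed

lemma measurable_score [measurable]: "score n v \<in> borel_measurable (law_Y n f0)"
  unfolding score_def
  by (intro borel_measurable_sum borel_measurable_times borel_measurable_const measurable_observation)

lemma measurable_slow_mixing:
  fixes n m L :: nat
  assumes n: "n = 2 ^ (m + 1)" and L: "L \<le> m" and p: "0 < p" "p < 1"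
  shows "{Y \<in> space (law_Y n f0). ereal r < ereal_of_enat (cart_mixing_time n L (\<lambda>_. p) Y \<epsilon>)} \<in> sets (law_Y n f0)"
proof -
  have weight: "(\<lambda>Y. tree_weight n p Y T) \<in> borel_measurable (law_Y n f0)" for T
    unfolding tree_weight_def node_evidence_def
    by (intro borel_measurable_times borel_measurable_const borel_measurable_prod
        borel_measurable_divide measurable_compose[OF _ borel_measurable_exp] borel_measurable_power
        measurable_score)
  have post: "(\<lambda>Y. posterior n L (\<lambda>_. p) Y T) \<in> borel_measurable (law_Y n f0)" if T: "T \<in> trees L" for T
    unfolding posterior_eq_tree_weight[OF n L p T]
    by (intro borel_measurable_divide borel_measurable_sum weight)
  have accept: "(\<lambda>Y. acceptance n L (\<lambda>_. p) Y T U) \<in> borel_measurable (law_Y n f0)"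
    if "T \<in> trees L" "U \<in> trees L" for T U
    unfolding acceptance_def using that
    by (intro borel_measurable_min borel_measurable_const borel_measurable_divide borel_measurable_times post)
  have kernel: "(\<lambda>Y. lazy_kernel n L (\<lambda>_. p) Y T U) \<in> borel_measurable (law_Y n f0)"
    if T: "T \<in> trees L" and U: "U \<in> trees L" for T U
  proof (cases "U = T")
    case True
    have "(\<lambda>Y. \<Sum>V\<in>trees L - {T}. proposal L T V * acceptance n L (\<lambda>_. p) Y T V) \<in> borel_measurable (law_Y n f0)"
      using T by (intro borel_measurable_sum borel_measurable_times borel_measurable_const accept) auto
    then show ?thesis using True by (simp add: lazy_kernel_def mh_kernel_def)
  next
    case False
    then show ?thesis using accept[OF T U] by (simp add: lazy_kernel_def mh_kernel_def)
  qed
  show ?thesis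
    unfolding cart_mixing_time_def
    using null_tree by (intro measurable_mixing_time kernel post) auto
qed

theorem theorem2:
  fixes c :: real
  assumes "c > 5/2"
  shows "\<exists>C A C_f0 :: real. C > 1 \<and> A > 0 \<and> C_f0 > 0 \<and>
    (\<forall>(L_max::nat) (L::nat) (n::nat). n = 2 ^ (L_max + 1) \<longrightarrow> 2 \<le> L \<longrightarrow> L \<le> L_max \<longrightarrow>
      (\<exists>f0 :: real \<Rightarrow> real. assumption_F_b A C_f0 n L f0 \<and>
        (\<forall>\<epsilon>::real. 0 < \<epsilon> \<longrightarrow> \<epsilon> < 1 \<longrightarrow>
          measure (law_Y n f0)
            {Y \<in> space (law_Y n f0).
               ereal_of_enat (cart_mixing_time n L (\<lambda>_. real n powr (- c)) Y \<epsilon>) >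
               ereal (ln (1 / (2 * \<epsilon>)) * (1/4) *
                 (((real n powr (c - 3/2) / 4 - 1) / C) ^ (L - 2) - 3))}
          \<ge> 1 - 4 / real n)))"
proof -
  define b where "b = 128 * (c + 3)"
  have b: "2 < b" using assms by (simp add: b_def)
  have main: "\<exists>f0. assumption_F_b 1 (b + 1) n L f0 \<and>
        (\<forall>\<epsilon>::real. 0 < \<epsilon> \<longrightarrow> \<epsilon> < 1 \<longrightarrow>
          measure (law_Y n f0)
            {Y \<in> space (law_Y n f0).
               ereal_of_enat (cart_mixing_time n L (\<lambda>_. real n powr (- c)) Y \<epsilon>) >
               ereal (ln (1 / (2 * \<epsilon>)) * (1/4) *
                 (((real n powr (c - 3/2) / 4 - 1) / 2) ^ (L - 2) - 3))}
          \<ge> 1 - 4 / real n)"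
    if n: "n = 2 ^ (m + 1)" and L: "2 \<le> L" "L \<le> m" for m L n :: nat
  proof -
    obtain d where d: "L = d + 2" using L(1) by (metis add.commute le_Suc_ex)
    let ?u = "Node (d + 1) 0"
    let ?f = "\<lambda>x. b * haar ?u x"
    have "(2::nat) ^ 1 \<le> 2 ^ (m + 1)" by (intro power_increasing) auto
    then have n2: "2 \<le> n" by (simp add: n)
    have "assumption_F_b 1 (b + 1) n L ?f"
      unfolding assumption_F_b_def
    proof (intro exI[of _ "{?u}"] exI[of _ "\<lambda>_. b"] conjI)
      have "ln (real n) \<le> 2 * sqrt (real n)" using n2 by (intro ln_le_2_sqrt) simp
      then have "1 * ln (real n) / sqrt (real n) \<le> 2" using n2 by (simp add: divide_le_eq)
      then show "\<forall>v\<in>{?u}. 1 * ln (real n) / sqrt (real n) < \<bar>b\<bar> \<and> \<bar>b\<bar> < b + 1" using b by auto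
    qed (auto simp: d trees_def)
    moreover have "1 - 4 / real n \<le> measure (law_Y n ?f)
            {Y \<in> space (law_Y n ?f).
               ereal_of_enat (cart_mixing_time n L (\<lambda>_. real n powr (- c)) Y \<epsilon>) >
               ereal (ln (1 / (2 * \<epsilon>)) * (1/4) *
                 (((real n powr (c - 3/2) / 4 - 1) / 2) ^ (L - 2) - 3))}"
      (is "_ \<le> measure _ ?slow") if \<epsilon>: "0 < \<epsilon>" "\<epsilon> < 1" for \<epsilon>
    proof -
      interpret prob_space "law_Y n ?f" by (rule prob_space_law_Y)
      have "real n powr (- c) < real n powr 0" using n2 assms by (intro powr_less_mono) auto
      then have p: "0 < real n powr (- c)" "real n powr (- c) < 1" using n2 by auto
      have "quiet_noise n L ?f \<subseteq> ?slow"
        using slow_mixing_on_quiet_noise[OF assms n _ \<epsilon>, of d] L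
        by (auto simp: d b_def quiet_noise_def)
      moreover have "?slow \<in> sets (law_Y n ?f)" using measurable_slow_mixing[OF n L(2) p] .
      ultimately have "prob (quiet_noise n L ?f) \<le> prob ?slow" by (rule finite_measure_mono)
      moreover have "1 - 1 / real n \<le> prob (quiet_noise n L ?f)"
        by (rule quiet_noise_likely(2)[OF n L(2)])
      moreover have "1 / real n \<le> 4 / real n" by (intro divide_right_mono) auto
      ultimately show ?thesis by linarith
    qed
    ultimately show ?thesis by blast
  qed
  show ?thesis
    by (rule exI[of _ 2], rule exI[of _ 1], rule exI[of _ "b + 1"]) (use main b in auto)
qed

end
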